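(* Let $\{c(r): r\in\mathbb{Z}\}$ be a real symmetric, positive definite sequence whose Fourier transform $f(\omega)=\sum_{r\in\mathbb{Z}}c(r)e^{ir\omega}$ satisfies $0<\inf_\omega f(\omega)\le\sup_\omega f(\omega)<\infty$. Let $\sigma^2$, $\phi_j$, $\phi(\cdot)$, $\psi(\cdot)$ be the quantities in the spectral factorization of $f$ described in the context, and for $\ell\ge0$ let $\phi_\ell(\omega)=\sum_{s=1}^{\infty}\phi_{\ell+s}e^{is\omega}$. Let ${\bf g}_+=(g_\ell;\ell\ge0)'\in\ell_2^+$ and consider the semi-infinite system of equations $$g_\ell=\sum_{j=0}^{\infty}h_jc(\ell-j),\qquad \ell\ge0,$$ that is, ${\bf g}_+=T(f){\bf h}_+$ with ${\bf h}_+=(h_j;j\ge 0)'$, whose solution is ${\bf h}_+=T(f)^{-1}{\bf g}_+$. Then $(h_j;j\ge0)'\in\ell_2^+$ and $H(\omega)=\sum_{j=0}^{\infty}h_je^{ij\omega}$ satisfies $$H(\omega)=\frac{\sum_{\ell=0}^{\infty}g_\ell\big(e^{i\ell\omega}+\psi(\omega)^*\phi_\ell(\omega)^*\big)}{f(\omega)}.$$ Moreover, $H(\omega)$ can be rewritten as $$H(\omega)=\sigma^{-2}\phi(\omega)\sum_{\ell=0}^{\infty}g_\ell\Big(e^{i\ell\omega}-\sum_{s=1}^{\ell}\phi_se^{i(\ell-s)\omega}\Big),$$ where for $\ell=0$ the inner sum is $0$.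
   Context: $\ell_2^+$ is the space of square-summable sequences $(v_0,v_1,\ldots)'$. $T(f)=(c(t-\tau);t,\tau\ge0)$ is the semi-infinite Toeplitz operator on $\ell_2^+$; it is well known that it is a bounded invertible operator on $\ell_2^+$ when $0<\inf_\omega f\le\sup_\omega f<\infty$. The superscript $*$ denotes complex conjugation. Spectral factorization: if $0<\inf_\omega f\le\sup_\omega f<\infty$, there are unique $\sigma^2>0$ and real square-summable sequences $(\psi_j)_{j\ge1}$, $(\phi_j)_{j\ge1}$ such that $\Psi(z)=1+\sum_{j\ge1}\psi_jz^j$ and $\Phi(z)=1-\sum_{j\ge1}\phi_jz^j$ satisfy $\Psi(z)\Phi(z)=1$ for $|z|<1$, and, with $\psi(\omega)=1+\sum_{j\ge1}\psi_je^{ij\omega}$ and $\phi(\omega)=1-\sum_{j\ge1}\phi_je^{ij\omega}=\psi(\omega)^{-1}$, one has $f(\omega)=\sigma^2|\psi(\omega)|^2=\sigma^2|\phi(\omega)|^{-2}$. Fourier series with square-summable coefficients are understood as elements of $L_2([0,2\pi))$; series of functions of $\omega$ converge in $L_2([0,2\pi))$ and identities between functions of $\omega$ are identities in $L_2([0,2\pi))$ (i.e. for almost every $\omega$). *)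

theory Defs
  imports "HOL-Analysis.Analysis" "HOL-Probability.Essential_Supremum"
begin

definition circle :: "real measure" where
  "circle = lebesgue_on {0..<2 * pi}"

definition square_integrable :: "(real \<Rightarrow> complex) \<Rightarrow> bool" where
  "square_integrable F \<longleftrightarrow>
     F \<in> borel_measurable circle \<and> integrable circle (\<lambda>\<omega>. (cmod (F \<omega>))\<^sup>2)"

text \<open>Square integrability of all the functions is part of the definition because the Bochner
  integral of a non-integrable function is \<open>0\<close>.\<close>

definition L2_tendsto :: "(nat \<Rightarrow> real \<Rightarrow> complex) \<Rightarrow> (real \<Rightarrow> complex) \<Rightarrow> bool" where
  "L2_tendsto F G \<longleftrightarrow>
     (\<forall>n. square_integrable (F n)) \<and> square_integrable G \<and>
     (\<lambda>n. LINT \<omega>|circle. (cmod (F n \<omega> - G \<omega>))\<^sup>2) \<longlonglongrightarrow> 0"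

definition L2_sums :: "(nat \<Rightarrow> real \<Rightarrow> complex) \<Rightarrow> (real \<Rightarrow> complex) \<Rightarrow> bool" where
  "L2_sums u G \<longleftrightarrow> L2_tendsto (\<lambda>n \<omega>. \<Sum>j<n. u j \<omega>) G"

definition L2_summable :: "(nat \<Rightarrow> real \<Rightarrow> complex) \<Rightarrow> bool" where
  "L2_summable u \<longleftrightarrow> (\<exists>G. L2_sums u G)"

text \<open>The sum is determined only almost everywhere; \<open>L2_suminf\<close> picks an arbitrary representative
  (and is unspecified for a series that is not \<open>L2_summable\<close>).\<close>

definition L2_suminf :: "(nat \<Rightarrow> real \<Rightarrow> complex) \<Rightarrow> real \<Rightarrow> complex" where
  "L2_suminf u = (SOME G. L2_sums u G)"

text \<open>Positive definiteness in the sense of Herglotz: all quadratic forms are non-negative.\<close>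

definition pos_def_seq :: "(int \<Rightarrow> real) \<Rightarrow> bool" where
  "pos_def_seq c \<longleftrightarrow>
     (\<forall>(n::nat) (a::nat \<Rightarrow> real). 0 \<le> (\<Sum>i<n. \<Sum>j<n. a i * a j * c (int i - int j)))"

definition fourier_transform :: "(int \<Rightarrow> real) \<Rightarrow> (real \<Rightarrow> real) \<Rightarrow> bool" where
  "fourier_transform c f \<longleftrightarrow>
     L2_tendsto (\<lambda>n \<omega>. \<Sum>r\<in>{- int n..int n}. of_real (c r) * cis (of_int r * \<omega>))
       (\<lambda>\<omega>. of_real (f \<omega>))"

text \<open>\<open>f\<close> is an element of $L_2$, so its infimum and supremum are the essential ones.\<close>

definition ess_sup :: "(real \<Rightarrow> real) \<Rightarrow> ereal" where
  "ess_sup f = esssup circle (\<lambda>\<omega>. ereal (f \<omega>))"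

definition ess_inf :: "(real \<Rightarrow> real) \<Rightarrow> ereal" where
  "ess_inf f = - esssup circle (\<lambda>\<omega>. - ereal (f \<omega>))"

text \<open>The coefficient sequences are indexed from 1: the values \<open>\<psi> 0\<close> and \<open>\<phi> 0\<close> are never used.\<close>

definition psi_fun :: "(nat \<Rightarrow> real) \<Rightarrow> real \<Rightarrow> complex" where
  "psi_fun \<psi> \<omega> = 1 + L2_suminf (\<lambda>j \<omega>. of_real (\<psi> (Suc j)) * cis (real (Suc j) * \<omega>)) \<omega>"

definition phi_fun :: "(nat \<Rightarrow> real) \<Rightarrow> real \<Rightarrow> complex" where
  "phi_fun \<phi> \<omega> = 1 - L2_suminf (\<lambda>j \<omega>. of_real (\<phi> (Suc j)) * cis (real (Suc j) * \<omega>)) \<omega>"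

definition phi_tail :: "(nat \<Rightarrow> real) \<Rightarrow> nat \<Rightarrow> real \<Rightarrow> complex" where
  "phi_tail \<phi> l \<omega> =
     L2_suminf (\<lambda>s \<omega>. of_real (\<phi> (l + Suc s)) * cis (real (Suc s) * \<omega>)) \<omega>"

definition spectral_factorization ::
  "(real \<Rightarrow> real) \<Rightarrow> real \<Rightarrow> (nat \<Rightarrow> real) \<Rightarrow> (nat \<Rightarrow> real) \<Rightarrow> bool" where
  "spectral_factorization f s2 \<psi> \<phi> \<longleftrightarrow>
     s2 > 0 \<and>
     summable (\<lambda>j. (\<psi> (Suc j))\<^sup>2) \<and> summable (\<lambda>j. (\<phi> (Suc j))\<^sup>2) \<and>
     (\<forall>z::complex. cmod z < 1 \<longrightarrow>
        (1 + (\<Sum>j. of_real (\<psi> (Suc j)) * z ^ Suc j)) *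
        (1 - (\<Sum>j. of_real (\<phi> (Suc j)) * z ^ Suc j)) = 1) \<and>
     (AE \<omega> in circle. phi_fun \<phi> \<omega> = inverse (psi_fun \<psi> \<omega>)) \<and>
     (AE \<omega> in circle. f \<omega> = s2 * (cmod (psi_fun \<psi> \<omega>))\<^sup>2) \<and>
     (AE \<omega> in circle. f \<omega> = s2 / (cmod (phi_fun \<phi> \<omega>))\<^sup>2)"

definition ell2_plus :: "(nat \<Rightarrow> complex) set" where
  "ell2_plus = {v. summable (\<lambda>j. (cmod (v j))\<^sup>2)}"

definition toeplitz :: "(int \<Rightarrow> real) \<Rightarrow> (nat \<Rightarrow> complex) \<Rightarrow> nat \<Rightarrow> complex" where
  "toeplitz c h l = (\<Sum>j. h j * of_real (c (int l - int j)))"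

definition toeplitz_inv :: "(int \<Rightarrow> real) \<Rightarrow> (nat \<Rightarrow> complex) \<Rightarrow> nat \<Rightarrow> complex" where
  "toeplitz_inv c = inv_into ell2_plus (toeplitz c)"

end

theory Submission
  imports Defs
begin

text \<open>Write $e_l$ for $e^{il\omega}$ and $K$ for the projection of $\phi^* G$ onto the non-negative
  frequencies, where $G = \sum_l g_l e_l$. Since $\phi^* e_l = u_l - \phi_l^*$, where the polynomial
  $u_l = e_l - \sum_{s=1}^{l} \phi_s e_{l-s}$ has non-negative and $\phi_l^*$ negative frequencies
  only, $K = \sum_l g_l u_l$. The function $H_0 = \sigma^{-2} \phi K$ has non-negative frequencies,
  and $f H_0 = \psi^* K = G - \psi^* (\phi^* G - K)$ has the coefficients $g_l$ for $l \ge 0$, because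
  $\psi^*$ preserves negative frequencies. So $H_0$ solves the system, and
  $f H_0 = \psi^* K = \sum_l g_l (e_l + \psi^* \phi_l^*)$. The solution is unique: if $X$
  has non-negative frequencies only and the coefficients of $f X$ at all $l \ge 0$ vanish, then
  $\int f |X|^2 = 0$.
  Working with the closed span of $e_j$, $j \ge 0$, instead of with functions whose negative
  coefficients vanish, makes completeness of the trigonometric system unnecessary.\<close>

subsection \<open>Completeness of $L_2$\<close>

text \<open>The formula for H_0 is Wiener--Hopf inversion: f = \<sigma>^2 \<psi>
  \<open>cnj \<psi>\<close> factors T(f) into \<sigma>^2 T(\<open>cnj \<psi>\<close>) T(\<psi>), so
  its inverse multiplies by \<open>cnj \<phi>\<close>, projects, multiplies by \<phi> and divides by
  \<sigma>^2. The u_l are not orthogonal, so square-summability of g alone does not make the series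
  of g_l u_l converge. The projection does: over a finite block of indices the sum of g_l u_l is the
  projection of \<open>cnj \<phi>\<close> times the same block of G, hence no larger in norm than
  that product, and \<phi> is essentially bounded. The bounds of \<psi> and \<phi> come from those
  of f through f = \<sigma>^2 |\<psi>|^2 = \<sigma>^2 / |\<phi>|^2. They keep products such as
  \<phi> K in L2 and make multiplication continuous, so that series may be multiplied term by term.
  No projection operator is built: K is the sum of its series, and it acts as a projection because
  the residual is orthogonal to every e_j with j >= 0.\<close>

text \<open>Takes the place of Minkowski's inequality: the L2 norm enters only squared, and the
  factor 2 is harmless in limits.\<close>

lemma norm_add_sq_le:
  fixes a b :: "'a::real_normed_vector"
  shows "(norm (a + b))\<^sup>2 \<le> 2 * (norm a)\<^sup>2 + 2 * (norm b)\<^sup>2"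
proof -
  have "(norm (a + b))\<^sup>2 \<le> (norm a + norm b)\<^sup>2"
    by (simp add: norm_triangle_ineq power_mono)
  also have "\<dots> \<le> 2 * (norm a)\<^sup>2 + 2 * (norm b)\<^sup>2"
    using sum_squares_bound[of "norm a" "norm b"] by (simp add: power2_sum)
  finally show ?thesis .
qed

lemma integrable_norm_sq_add:
  fixes F G :: "'a \<Rightarrow> 'b::{banach, second_countable_topology}"
  assumes [measurable]: "F \<in> borel_measurable M" "G \<in> borel_measurable M"
    and "integrable M (\<lambda>x. (norm (F x))\<^sup>2)" "integrable M (\<lambda>x. (norm (G x))\<^sup>2)"
  shows "integrable M (\<lambda>x. (norm (F x + G x))\<^sup>2)"
  by (rule Bochner_Integration.integrable_bound
        [where f = "\<lambda>x. 2 * (norm (F x))\<^sup>2 + 2 * (norm (G x))\<^sup>2"])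
     (use assms in \<open>auto simp: norm_add_sq_le\<close>)

lemma integrable_norm_sq_diff:
  fixes F G :: "'a \<Rightarrow> 'b::{banach, second_countable_topology}"
  assumes [measurable]: "F \<in> borel_measurable M" "G \<in> borel_measurable M"
    and "integrable M (\<lambda>x. (norm (F x))\<^sup>2)" "integrable M (\<lambda>x. (norm (G x))\<^sup>2)"
  shows "integrable M (\<lambda>x. (norm (F x - G x))\<^sup>2)"
  using integrable_norm_sq_add[of F M "\<lambda>x. - G x"] assms by simp

text \<open>Riesz--Fischer: a rapidly Cauchy subsequence converges almost everywhere, and Fatou's
  lemma transfers the Cauchy bound to its limit.\<close>

lemma L2_complete:
  fixes F :: "nat \<Rightarrow> 'a \<Rightarrow> 'b::{banach, second_countable_topology}"
  assumes meas [measurable]: "\<And>n. F n \<in> borel_measurable M"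
    and int: "\<And>n. integrable M (\<lambda>x. (norm (F n x))\<^sup>2)"
    and Cauchy: "\<And>e. e > 0 \<Longrightarrow>
      \<exists>N. \<forall>m\<ge>N. \<forall>n\<ge>N. (LINT x|M. (norm (F m x - F n x))\<^sup>2) < e"
  obtains G where "G \<in> borel_measurable M" "integrable M (\<lambda>x. (norm (G x))\<^sup>2)"
    "(\<lambda>n. LINT x|M. (norm (F n x - G x))\<^sup>2) \<longlonglongrightarrow> 0"
proof -
  have int_diff: "integrable M (\<lambda>x. (norm (F m x - F n x))\<^sup>2)" for m n
    by (intro integrable_norm_sq_diff meas int)
  have "\<forall>k. \<exists>N. \<forall>m\<ge>N. \<forall>n\<ge>N. (LINT x|M. (norm (F m x - F n x))\<^sup>2) < (1/4) ^ k"
    by (intro allI Cauchy) simp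
  then obtain N where N: "\<And>k m n. N k \<le> m \<Longrightarrow> N k \<le> n \<Longrightarrow>
      (LINT x|M. (norm (F m x - F n x))\<^sup>2) < (1/4) ^ k"
    by metis
  \<comment> \<open>Summing all \<open>N i\<close> up to k makes \<open>r\<close> monotone and at
    least \<open>N k\<close>; the extra k sends it to infinity.\<close>
  define r where "r k = (\<Sum>i\<le>k. N i) + k" for k
  have r_ge: "N k \<le> r k" "k \<le> r k" for k
    by (auto simp: r_def intro!: trans_le_add1 member_le_sum)
  have r_Suc: "r k \<le> r (Suc k)" for k by (simp add: r_def)
  define d where "d k x = norm (F (r (Suc k)) x - F (r k) x)" for k x
  have d_meas [measurable]: "d k \<in> borel_measurable M" for k
    unfolding d_def[abs_def] by measurable
  have d_int: "integrable M (\<lambda>x. (d k x)\<^sup>2)" for k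
    unfolding d_def by (rule int_diff)
  \<comment> \<open>The weight \<open>2 ^ k\<close> spends half of the decay of
    \<open>(1/4) ^ k\<close> and still leaves a summable bound.\<close>
  have d_le: "(LINT x|M. 2 ^ k * (d k x)\<^sup>2) \<le> (1/2) ^ k" for k
  proof -
    have "(LINT x|M. (d k x)\<^sup>2) \<le> (1/4) ^ k"
      unfolding d_def using N[of k "r (Suc k)" "r k"] r_ge(1)[of k] r_Suc[of k] by simp
    then have "2 ^ k * (LINT x|M. (d k x)\<^sup>2) \<le> 2 ^ k * (1/4) ^ k" by simp
    also have "\<dots> = (1/2) ^ k" by (simp flip: power_mult_distrib)
    finally show ?thesis by simp
  qed
  have "(\<integral>\<^sup>+x. (\<Sum>k. ennreal (2 ^ k * (d k x)\<^sup>2)) \<partial>M)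
      = (\<Sum>k. \<integral>\<^sup>+x. ennreal (2 ^ k * (d k x)\<^sup>2) \<partial>M)"
    by (rule nn_integral_suminf) measurable
  also have "\<dots> = (\<Sum>k. ennreal (LINT x|M. 2 ^ k * (d k x)\<^sup>2))"
    by (intro suminf_cong nn_integral_eq_integral) (auto intro!: d_int)
  also have "\<dots> \<le> (\<Sum>k. ennreal ((1/2) ^ k))"
    by (intro suminf_le ennreal_leI d_le) auto
  also have "\<dots> = ennreal (\<Sum>k. (1/2) ^ k)"
    by (rule suminf_ennreal2) (auto intro!: summable_geometric)
  finally have "(\<integral>\<^sup>+x. (\<Sum>k. ennreal (2 ^ k * (d k x)\<^sup>2)) \<partial>M) \<noteq> \<infinity>"
    by (auto simp: top_unique)
  then have "AE x in M. (\<Sum>k. ennreal (2 ^ k * (d k x)\<^sup>2)) \<noteq> \<infinity>"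
    by (intro nn_integral_PInf_AE) measurable
  then have conv: "AE x in M. convergent (\<lambda>k. F (r k) x)"
  proof eventually_elim
    case (elim x)
    then have "summable (\<lambda>k. 2 ^ k * (d k x)\<^sup>2)"
      by (intro summable_suminf_not_top) auto
    then have s: "summable (\<lambda>k. 2 ^ k * (d k x)\<^sup>2 + (1/2) ^ k)"
      by (intro summable_add summable_geometric) auto
    \<comment> \<open>AM-GM with the weight $2^k$ replaces the bound of $L_1$ by $L_2$, which needs a finite measure.\<close>
    have "d k x \<le> 2 ^ k * (d k x)\<^sup>2 + (1/2) ^ k" for k
    proof -
      have "0 \<le> (2 ^ k * d k x - 1)\<^sup>2 / 2 ^ k" by simp
      also have "\<dots> = 2 ^ k * (d k x)\<^sup>2 - 2 * d k x + (1/2) ^ k"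
        by (simp add: power2_diff power_divide field_simps power2_eq_square)
      finally show ?thesis by (simp add: d_def) (smt (verit) norm_ge_zero)
    qed
    then have "summable (\<lambda>k. norm (F (r (Suc k)) x - F (r k) x))"
      by (intro summable_comparison_test'[OF s, of 0]) (auto simp: d_def)
    then have "summable (\<lambda>k. F (r (Suc k)) x - F (r k) x)"
      by (rule summable_norm_cancel)
    then have "convergent (\<lambda>n. \<Sum>k<n. F (r (Suc k)) x - F (r k) x)"
      by (simp add: summable_iff_convergent)
    then have "convergent (\<lambda>n. F (r n) x - F (r 0) x)"
      by (simp only: sum_lessThan_telescope[of "\<lambda>k. F (r k) x"])
    then have "convergent (\<lambda>n. (F (r n) x - F (r 0) x) + F (r 0) x)"
      by (intro convergent_add convergent_const)
    then show ?case by simp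
  qed
  \<comment> \<open>On the null set where the subsequence diverges, \<open>lim\<close> is an
    unspecified value; measurability is unaffected.\<close>
  define G where "G x = lim (\<lambda>k. F (r k) x)" for x
  have G_meas [measurable]: "G \<in> borel_measurable M"
    unfolding G_def[abs_def] by (rule borel_measurable_lim_metric) simp
  \<comment> \<open>Fatou along \<open>r\<close>. The non-negative integral is used because
    integrability of the squared difference is not yet known; it is deduced from this bound.\<close>
  have bound: "(\<integral>\<^sup>+x. ennreal ((norm (F n x - G x))\<^sup>2) \<partial>M) \<le> ennreal e"
    if n: "n \<ge> K" and K: "\<forall>m\<ge>K. \<forall>n\<ge>K. (LINT x|M. (norm (F m x - F n x))\<^sup>2) < e" for n K e
  proof -
    have "(\<integral>\<^sup>+x. ennreal ((norm (F n x - G x))\<^sup>2) \<partial>M)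
        = (\<integral>\<^sup>+x. liminf (\<lambda>k. ennreal ((norm (F n x - F (r k) x))\<^sup>2)) \<partial>M)"
    proof (rule nn_integral_cong_AE, use conv in eventually_elim)
      case (elim x)
      then have "(\<lambda>k. F (r k) x) \<longlonglongrightarrow> G x"
        by (simp add: G_def convergent_LIMSEQ_iff)
      then have "(\<lambda>k. ennreal ((norm (F n x - F (r k) x))\<^sup>2)) \<longlonglongrightarrow> ennreal ((norm (F n x - G x))\<^sup>2)"
        by (intro tendsto_intros)
      then show ?case
        by (intro lim_imp_Liminf[symmetric]) auto
    qed
    also have "\<dots> \<le> liminf (\<lambda>k. \<integral>\<^sup>+x. ennreal ((norm (F n x - F (r k) x))\<^sup>2) \<partial>M)"
      by (rule nn_integral_liminf) measurable
    also have "\<dots> = liminf (\<lambda>k. ennreal (LINT x|M. (norm (F n x - F (r k) x))\<^sup>2))"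
      by (subst nn_integral_eq_integral) (auto intro!: int_diff)
    also have "\<dots> \<le> limsup (\<lambda>k. ennreal (LINT x|M. (norm (F n x - F (r k) x))\<^sup>2))"
      by (rule Liminf_le_Limsup) simp
    also have "\<dots> \<le> ennreal e"
    proof (rule Limsup_bounded, rule eventually_sequentiallyI[of K])
      fix k assume "K \<le> k"
      then have "K \<le> r k" using r_ge(2)[of k] by simp
      then show "ennreal (LINT x|M. (norm (F n x - F (r k) x))\<^sup>2) \<le> ennreal e"
        using K n by (intro ennreal_leI less_imp_le) auto
    qed
    finally show ?thesis .
  qed
  have int_FG: "integrable M (\<lambda>x. (norm (F n x - G x))\<^sup>2) \<and> (LINT x|M. (norm (F n x - G x))\<^sup>2) \<le> e"
    if "n \<ge> K" "\<forall>m\<ge>K. \<forall>n\<ge>K. (LINT x|M. (norm (F m x - F n x))\<^sup>2) < e" "e > 0" for n K e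
  proof
    show *: "integrable M (\<lambda>x. (norm (F n x - G x))\<^sup>2)"
      using bound[OF that(1,2)]
      by (intro integrableI_bounded) (auto simp: top_unique less_top[symmetric])
    show "(LINT x|M. (norm (F n x - G x))\<^sup>2) \<le> e"
      using bound[OF that(1,2)] \<open>e > 0\<close> by (simp add: nn_integral_eq_integral[OF *])
  qed
  obtain K where K: "\<forall>m\<ge>K. \<forall>n\<ge>K. (LINT x|M. (norm (F m x - F n x))\<^sup>2) < 1"
    using Cauchy[of 1] by auto
  have "integrable M (\<lambda>x. (norm (F K x - (F K x - G x)))\<^sup>2)"
    using int_FG[OF _ K, of K] by (intro integrable_norm_sq_diff[of "F K" M "\<lambda>x. F K x - G x", OF meas _ int]) auto
  then have "integrable M (\<lambda>x. (norm (G x))\<^sup>2)" by simp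
  moreover have "(\<lambda>n. LINT x|M. (norm (F n x - G x))\<^sup>2) \<longlonglongrightarrow> 0"
  proof (rule LIMSEQ_I)
    fix e :: real assume "0 < e"
    then obtain K where K: "\<forall>m\<ge>K. \<forall>n\<ge>K. (LINT x|M. (norm (F m x - F n x))\<^sup>2) < e / 2"
      using Cauchy[of "e / 2"] by auto
    have "(LINT x|M. (norm (F n x - G x))\<^sup>2) < e" if "n \<ge> K" for n
      using int_FG[OF that K] \<open>0 < e\<close> by simp
    then show "\<exists>N. \<forall>n\<ge>N. norm ((LINT x|M. (norm (F n x - G x))\<^sup>2) - 0) < e"
      by (auto intro!: exI[of _ K])
  qed
  ultimately show thesis using that G_meas by blast
qed

subsection \<open>Square-integrable functions on the circle\<close>

lemma finite_measure_circle: "finite_measure circle"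
  unfolding circle_def by (intro finite_measure_lebesgue_on bounded_set_imp_lmeasurable) auto

lemma borel_measurable_circle [measurable (raw)]:
  "F \<in> borel_measurable borel \<Longrightarrow> F \<in> borel_measurable circle"
  unfolding circle_def by (intro measurable_restrict_space1 measurable_completion) simp

text \<open>Taken with respect to plain Lebesgue measure, so exponentials have squared norm 2 pi;
  the normalization enters only in \<open>fcoef\<close>.\<close>

definition L2_sq :: "(real \<Rightarrow> complex) \<Rightarrow> real" where
  "L2_sq F = (LINT \<omega>|circle. (cmod (F \<omega>))\<^sup>2)"

definition L2_inner :: "(real \<Rightarrow> complex) \<Rightarrow> (real \<Rightarrow> complex) \<Rightarrow> complex" where
  "L2_inner F G = (LINT \<omega>|circle. F \<omega> * cnj (G \<omega>))"

lemma square_integrable_measurable [measurable_dest]: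
  "square_integrable F \<Longrightarrow> F \<in> borel_measurable circle"
  by (simp add: square_integrable_def)

lemma square_integrable_integrable:
  "square_integrable F \<Longrightarrow> integrable circle (\<lambda>\<omega>. (cmod (F \<omega>))\<^sup>2)"
  by (simp add: square_integrable_def)

lemma square_integrable_add:
  "square_integrable F \<Longrightarrow> square_integrable G \<Longrightarrow> square_integrable (\<lambda>\<omega>. F \<omega> + G \<omega>)"
  unfolding square_integrable_def by (auto intro!: integrable_norm_sq_add)

lemma square_integrable_diff:
  "square_integrable F \<Longrightarrow> square_integrable G \<Longrightarrow> square_integrable (\<lambda>\<omega>. F \<omega> - G \<omega>)"
  unfolding square_integrable_def by (auto intro!: integrable_norm_sq_diff)

text \<open>The bound is required only almost everywhere, which is all that can hold for
  \<open>psi_fun\<close> and \<open>phi_fun\<close>, built from arbitrary L2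
  representatives.\<close>

lemma square_integrable_bounded_mult:
  assumes [measurable]: "B \<in> borel_measurable circle" and B: "AE \<omega> in circle. cmod (B \<omega>) \<le> C"
    and F: "square_integrable F"
  shows "square_integrable (\<lambda>\<omega>. B \<omega> * F \<omega>)"
    and "L2_sq (\<lambda>\<omega>. B \<omega> * F \<omega>) \<le> C\<^sup>2 * L2_sq F"
proof -
  have [measurable]: "F \<in> borel_measurable circle" using F by measurable
  have i: "integrable circle (\<lambda>\<omega>. C\<^sup>2 * (cmod (F \<omega>))\<^sup>2)"
    using square_integrable_integrable[OF F] by simp
  have le: "AE \<omega> in circle. (cmod (B \<omega> * F \<omega>))\<^sup>2 \<le> C\<^sup>2 * (cmod (F \<omega>))\<^sup>2"
    using B by eventually_elim (simp add: norm_mult power_mult_distrib mult_right_mono power_mono)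
  have *: "integrable circle (\<lambda>\<omega>. (cmod (B \<omega> * F \<omega>))\<^sup>2)"
    by (rule Bochner_Integration.integrable_bound[OF i]) (use le in auto)
  then show "square_integrable (\<lambda>\<omega>. B \<omega> * F \<omega>)"
    by (simp add: square_integrable_def)
  show "L2_sq (\<lambda>\<omega>. B \<omega> * F \<omega>) \<le> C\<^sup>2 * L2_sq F"
    using integral_mono_AE[OF * i le] by (simp add: L2_sq_def)
qed

lemma square_integrable_cmult:
  "square_integrable F \<Longrightarrow> square_integrable (\<lambda>\<omega>. a * F \<omega>)"
  by (rule square_integrable_bounded_mult(1)[where C = "cmod a"]) auto

lemma square_integrable_const: "square_integrable (\<lambda>\<omega>. a)"
  using finite_measure.integrable_const[OF finite_measure_circle, of "(cmod a)\<^sup>2"]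
  by (simp add: square_integrable_def)

lemma square_integrable_sum:
  "(\<And>j. j \<in> A \<Longrightarrow> square_integrable (u j)) \<Longrightarrow> square_integrable (\<lambda>\<omega>. \<Sum>j\<in>A. u j \<omega>)"
  by (induction A rule: infinite_finite_induct)
     (auto intro!: square_integrable_const square_integrable_add)

lemma borel_measurable_cnj [measurable (raw)]:
  "F \<in> borel_measurable M \<Longrightarrow> (\<lambda>x. cnj (F x)) \<in> borel_measurable M"
  by (rule measurable_compose[OF _ borel_measurable_continuous_onI]) (auto intro!: continuous_intros)

lemma integrable_mult_cnj:
  assumes "square_integrable F" "square_integrable G"
  shows "integrable circle (\<lambda>\<omega>. F \<omega> * cnj (G \<omega>))"
proof (rule Bochner_Integration.integrable_bound)
  show "integrable circle (\<lambda>\<omega>. (cmod (F \<omega>))\<^sup>2 + (cmod (G \<omega>))\<^sup>2)"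
    using assms by (intro Bochner_Integration.integrable_add square_integrable_integrable)
  show "(\<lambda>\<omega>. F \<omega> * cnj (G \<omega>)) \<in> borel_measurable circle"
    using assms[THEN square_integrable_measurable] by measurable
  have "cmod a * cmod b \<le> (cmod a)\<^sup>2 + (cmod b)\<^sup>2" for a b
    using sum_squares_bound[of "cmod a" "cmod b"]
      mult_nonneg_nonneg[OF norm_ge_zero[of a] norm_ge_zero[of b]] by linarith
  then show "AE \<omega> in circle. norm (F \<omega> * cnj (G \<omega>)) \<le> norm ((cmod (F \<omega>))\<^sup>2 + (cmod (G \<omega>))\<^sup>2)"
    by (auto simp: norm_mult)
qed

lemma L2_sq_nonneg: "0 \<le> L2_sq F"
  by (simp add: L2_sq_def)

lemma L2_inner_self: "L2_inner F F = of_real (L2_sq F)"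
  by (simp add: L2_inner_def L2_sq_def complex_norm_square[symmetric]
      flip: integral_complex_of_real of_real_power)

lemma L2_inner_commute: "L2_inner G F = cnj (L2_inner F G)"
  using Bochner_Integration.integral_cnj[of circle "\<lambda>\<omega>. F \<omega> * cnj (G \<omega>)"]
  by (simp add: L2_inner_def mult.commute del: Bochner_Integration.integral_cnj)

lemma L2_inner_add_left:
  assumes "square_integrable F" "square_integrable G" "square_integrable K"
  shows "L2_inner (\<lambda>\<omega>. F \<omega> + G \<omega>) K = L2_inner F K + L2_inner G K"
  unfolding L2_inner_def using assms by (simp add: distrib_right integrable_mult_cnj)

lemma L2_inner_diff_left:
  assumes "square_integrable F" "square_integrable G" "square_integrable K"
  shows "L2_inner (\<lambda>\<omega>. F \<omega> - G \<omega>) K = L2_inner F K - L2_inner G K"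
  unfolding L2_inner_def using assms by (simp add: left_diff_distrib integrable_mult_cnj)

lemma L2_inner_cmult_left: "L2_inner (\<lambda>\<omega>. a * F \<omega>) K = a * L2_inner F K"
  by (simp add: L2_inner_def mult.assoc)

lemma L2_inner_sum_left:
  assumes "\<And>j. j \<in> A \<Longrightarrow> square_integrable (u j)" "square_integrable K"
  shows "L2_inner (\<lambda>\<omega>. \<Sum>j\<in>A. u j \<omega>) K = (\<Sum>j\<in>A. L2_inner (u j) K)"
  unfolding L2_inner_def using assms
  by (simp add: sum_distrib_right integrable_mult_cnj)

lemma L2_inner_sum_right:
  assumes "\<And>j. j \<in> A \<Longrightarrow> square_integrable (u j)" "square_integrable K"
  shows "L2_inner K (\<lambda>\<omega>. \<Sum>j\<in>A. u j \<omega>) = (\<Sum>j\<in>A. L2_inner K (u j))"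
  by (subst (1 2) L2_inner_commute) (simp add: L2_inner_sum_left assms)

lemma L2_inner_cmult_right: "L2_inner K (\<lambda>\<omega>. a * F \<omega>) = cnj a * L2_inner K F"
  by (subst (1 2) L2_inner_commute) (simp add: L2_inner_cmult_left)

text \<open>Multiplications by \<open>B\<close> and by \<open>cnj B\<close> are adjoint: both sides
  integrate the same product.\<close>

lemma L2_inner_mult_left: "L2_inner (\<lambda>\<omega>. B \<omega> * F \<omega>) G = L2_inner F (\<lambda>\<omega>. cnj (B \<omega>) * G \<omega>)"
  by (simp add: L2_inner_def mult_ac)

lemma L2_inner_cong_AE:
  assumes "AE \<omega> in circle. F \<omega> = F' \<omega>"
    "square_integrable F" "square_integrable F'" "square_integrable G"
  shows "L2_inner F G = L2_inner F' G"
  unfolding L2_inner_def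
  by (rule integral_cong_AE)
     (use assms integrable_mult_cnj[THEN borel_measurable_integrable] in \<open>auto elim: AE_mp\<close>)

lemma L2_pythagoras:
  assumes F: "square_integrable F" and G: "square_integrable G" and orth: "L2_inner F G = 0"
  shows "L2_sq (\<lambda>\<omega>. F \<omega> + G \<omega>) = L2_sq F + L2_sq G"
proof -
  have "L2_sq (\<lambda>\<omega>. F \<omega> + G \<omega>)
      = (LINT \<omega>|circle. ((cmod (F \<omega>))\<^sup>2 + (cmod (G \<omega>))\<^sup>2) + 2 * Re (F \<omega> * cnj (G \<omega>)))"
    unfolding L2_sq_def
    by (intro Bochner_Integration.integral_cong refl)
       (simp only: cmod_power2, simp add: power2_eq_square algebra_simps)
  also have "\<dots> = L2_sq F + L2_sq G + 2 * (LINT \<omega>|circle. Re (F \<omega> * cnj (G \<omega>)))"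
    unfolding L2_sq_def using integrable_mult_cnj[OF F G] F G
    by (subst Bochner_Integration.integral_add)
       (auto simp del: times_complex.simps simp: square_integrable_integrable intro!: integrable_Re)
  also have "(LINT \<omega>|circle. Re (F \<omega> * cnj (G \<omega>))) = Re (L2_inner F G)"
    unfolding L2_inner_def by (rule integral_Re[OF integrable_mult_cnj[OF F G]])
  finally show ?thesis using orth by simp
qed

text \<open>Cauchy--Schwarz with a free weight, from pointwise AM-GM. Keeping \<open>t\<close>
  instead of optimizing it avoids square roots and the case of a zero norm.\<close>

lemma norm_L2_inner_le:
  assumes F: "square_integrable F" and G: "square_integrable G" and t: "t > 0"
  shows "cmod (L2_inner F G) \<le> t * L2_sq F + L2_sq G / t"
proof -
  have "cmod (L2_inner F G) \<le> (LINT \<omega>|circle. t * (cmod (F \<omega>))\<^sup>2 + (cmod (G \<omega>))\<^sup>2 / t)"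
    unfolding L2_inner_def
  proof (rule Bochner_Integration.integral_norm_bound_integral)
    show "integrable circle (\<lambda>\<omega>. F \<omega> * cnj (G \<omega>))" by (rule integrable_mult_cnj[OF F G])
    show "integrable circle (\<lambda>\<omega>. t * (cmod (F \<omega>))\<^sup>2 + (cmod (G \<omega>))\<^sup>2 / t)"
      using F G by (auto intro!: square_integrable_integrable)
    fix \<omega>
    have "0 \<le> (t * cmod (F \<omega>) - cmod (G \<omega>))\<^sup>2 / t" using t by simp
    also have "\<dots> = t * (cmod (F \<omega>))\<^sup>2 + (cmod (G \<omega>))\<^sup>2 / t - 2 * (cmod (F \<omega>) * cmod (G \<omega>))"
      using t by (simp add: power2_eq_square field_simps)
    finally show "norm (F \<omega> * cnj (G \<omega>)) \<le> t * (cmod (F \<omega>))\<^sup>2 + (cmod (G \<omega>))\<^sup>2 / t"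
      using mult_nonneg_nonneg[OF norm_ge_zero norm_ge_zero, of "F \<omega>" "G \<omega>"]
      by (simp only: norm_mult complex_mod_cnj)
  qed
  also have "\<dots> = t * L2_sq F + L2_sq G / t"
    unfolding L2_sq_def using F G
    by (subst Bochner_Integration.integral_add) (auto intro!: square_integrable_integrable)
  finally show ?thesis .
qed

lemma L2_sq_add_le:
  assumes "square_integrable F" "square_integrable G"
  shows "L2_sq (\<lambda>\<omega>. F \<omega> + G \<omega>) \<le> 2 * L2_sq F + 2 * L2_sq G"
proof -
  have "L2_sq (\<lambda>\<omega>. F \<omega> + G \<omega>) \<le> (LINT \<omega>|circle. 2 * (cmod (F \<omega>))\<^sup>2 + 2 * (cmod (G \<omega>))\<^sup>2)"
    unfolding L2_sq_def using assms
    by (intro integral_mono norm_add_sq_le)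
       (auto intro!: square_integrable_integrable square_integrable_add)
  also have "\<dots> = 2 * L2_sq F + 2 * L2_sq G"
    unfolding L2_sq_def using assms
    by (subst Bochner_Integration.integral_add) (auto intro!: square_integrable_integrable)
  finally show ?thesis .
qed

lemma L2_sq_cong_AE:
  assumes "AE \<omega> in circle. F \<omega> = F' \<omega>" "square_integrable F" "square_integrable F'"
  shows "L2_sq F = L2_sq F'"
  unfolding L2_sq_def
  by (rule integral_cong_AE)
     (use assms square_integrable_integrable[THEN borel_measurable_integrable] in
       \<open>auto elim: AE_mp\<close>)

lemma L2_sq_eq_0_imp:
  assumes "square_integrable F" "L2_sq F = 0"
  shows "AE \<omega> in circle. F \<omega> = 0"
  using assms integral_nonneg_eq_0_iff_AE[of circle "\<lambda>\<omega>. (cmod (F \<omega>))\<^sup>2"]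
  by (simp add: L2_sq_def square_integrable_integrable)

subsection \<open>$L_2$ limits and series\<close>

lemma L2_tendsto_iff:
  "L2_tendsto F G \<longleftrightarrow> (\<forall>n. square_integrable (F n)) \<and> square_integrable G \<and>
     (\<lambda>n. L2_sq (\<lambda>\<omega>. F n \<omega> - G \<omega>)) \<longlonglongrightarrow> 0"
  by (simp add: L2_tendsto_def L2_sq_def)

lemma L2_tendstoD:
  assumes "L2_tendsto F G"
  shows "square_integrable (F n)" "square_integrable G"
    "(\<lambda>n. L2_sq (\<lambda>\<omega>. F n \<omega> - G \<omega>)) \<longlonglongrightarrow> 0"
  using assms by (auto simp: L2_tendsto_iff)

lemma L2_tendsto_const: "square_integrable G \<Longrightarrow> L2_tendsto (\<lambda>n. G) G"
  by (simp add: L2_tendsto_iff L2_sq_def)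

lemma L2_tendsto_add:
  assumes "L2_tendsto F G" "L2_tendsto F' G'"
  shows "L2_tendsto (\<lambda>n \<omega>. F n \<omega> + F' n \<omega>) (\<lambda>\<omega>. G \<omega> + G' \<omega>)"
  unfolding L2_tendsto_iff
proof (intro conjI allI)
  note D = L2_tendstoD[OF assms(1)] L2_tendstoD[OF assms(2)]
  show "(\<lambda>n. L2_sq (\<lambda>\<omega>. F n \<omega> + F' n \<omega> - (G \<omega> + G' \<omega>))) \<longlonglongrightarrow> 0"
  proof (rule tendsto_sandwich[OF _ _ tendsto_const])
    show "(\<lambda>n. 2 * L2_sq (\<lambda>\<omega>. F n \<omega> - G \<omega>) + 2 * L2_sq (\<lambda>\<omega>. F' n \<omega> - G' \<omega>)) \<longlonglongrightarrow> 0"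
      using tendsto_add[OF tendsto_mult_left[OF D(3), of 2] tendsto_mult_left[OF D(6), of 2]]
      by simp
    show "\<forall>\<^sub>F n in sequentially. L2_sq (\<lambda>\<omega>. F n \<omega> + F' n \<omega> - (G \<omega> + G' \<omega>))
        \<le> 2 * L2_sq (\<lambda>\<omega>. F n \<omega> - G \<omega>) + 2 * L2_sq (\<lambda>\<omega>. F' n \<omega> - G' \<omega>)"
      using L2_sq_add_le[OF square_integrable_diff[OF D(1,2)] square_integrable_diff[OF D(4,5)]]
      by (intro always_eventually allI) (simp add: add_diff_add)
  qed (simp add: L2_sq_nonneg)
qed (use L2_tendstoD[OF assms(1)] L2_tendstoD[OF assms(2)] in \<open>auto intro: square_integrable_add\<close>)

lemma L2_tendsto_bounded_mult:
  assumes B: "B \<in> borel_measurable circle" "AE \<omega> in circle. cmod (B \<omega>) \<le> C"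
    and F: "L2_tendsto F G"
  shows "L2_tendsto (\<lambda>n \<omega>. B \<omega> * F n \<omega>) (\<lambda>\<omega>. B \<omega> * G \<omega>)"
  unfolding L2_tendsto_iff
proof (intro conjI allI)
  note D = L2_tendstoD[OF F]
  show "(\<lambda>n. L2_sq (\<lambda>\<omega>. B \<omega> * F n \<omega> - B \<omega> * G \<omega>)) \<longlonglongrightarrow> 0"
  proof (rule tendsto_sandwich[OF _ _ tendsto_const])
    show "(\<lambda>n. C\<^sup>2 * L2_sq (\<lambda>\<omega>. F n \<omega> - G \<omega>)) \<longlonglongrightarrow> 0"
      using tendsto_mult_left[OF D(3), of "C\<^sup>2"] by simp
    show "\<forall>\<^sub>F n in sequentially. L2_sq (\<lambda>\<omega>. B \<omega> * F n \<omega> - B \<omega> * G \<omega>)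
        \<le> C\<^sup>2 * L2_sq (\<lambda>\<omega>. F n \<omega> - G \<omega>)"
      using square_integrable_bounded_mult(2)[OF B square_integrable_diff[OF D(1,2)]]
      by (intro always_eventually allI) (simp add: right_diff_distrib)
  qed (simp add: L2_sq_nonneg)
qed (use B L2_tendstoD[OF F] in \<open>auto intro: square_integrable_bounded_mult\<close>)

lemma L2_tendsto_cmult:
  "L2_tendsto F G \<Longrightarrow> L2_tendsto (\<lambda>n \<omega>. a * F n \<omega>) (\<lambda>\<omega>. a * G \<omega>)"
  by (rule L2_tendsto_bounded_mult[where C = "cmod a"]) auto

lemma L2_tendsto_diff:
  assumes "L2_tendsto F G" "L2_tendsto F' G'"
  shows "L2_tendsto (\<lambda>n \<omega>. F n \<omega> - F' n \<omega>) (\<lambda>\<omega>. G \<omega> - G' \<omega>)"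
  using L2_tendsto_add[OF assms(1) L2_tendsto_cmult[OF assms(2), of "-1"]] by simp

lemma L2_tendsto_cong_AE:
  assumes F: "L2_tendsto F G"
    and ae: "\<And>n. AE \<omega> in circle. F n \<omega> = F' n \<omega>" "AE \<omega> in circle. G \<omega> = G' \<omega>"
    and sq: "\<And>n. square_integrable (F' n)" "square_integrable G'"
  shows "L2_tendsto F' G'"
proof -
  have "L2_sq (\<lambda>\<omega>. F' n \<omega> - G' \<omega>) = L2_sq (\<lambda>\<omega>. F n \<omega> - G \<omega>)" for n
  proof (rule L2_sq_cong_AE)
    show "AE \<omega> in circle. F' n \<omega> - G' \<omega> = F n \<omega> - G \<omega>"
      using ae(1)[of n] ae(2) by eventually_elim simp
  qed (use sq L2_tendstoD[OF F] in \<open>auto intro: square_integrable_diff\<close>)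
  then show ?thesis
    using F sq by (simp add: L2_tendsto_iff)
qed

lemma L2_tendsto_unique:
  assumes "L2_tendsto F G" "L2_tendsto F G'"
  shows "AE \<omega> in circle. G \<omega> = G' \<omega>"
proof -
  have "L2_tendsto (\<lambda>n \<omega>. 0) (\<lambda>\<omega>. G \<omega> - G' \<omega>)"
    using L2_tendsto_diff[OF assms] by simp
  then have "square_integrable (\<lambda>\<omega>. G \<omega> - G' \<omega>)" "L2_sq (\<lambda>\<omega>. G \<omega> - G' \<omega>) = 0"
    by (auto simp: L2_tendsto_iff LIMSEQ_const_iff L2_sq_def norm_minus_commute)
  then show ?thesis using L2_sq_eq_0_imp by fastforce
qed

lemma tendsto_L2_inner_left:
  assumes F: "L2_tendsto F G" and K: "square_integrable K"
  shows "(\<lambda>n. L2_inner (F n) K) \<longlonglongrightarrow> L2_inner G K"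
proof (rule LIMSEQ_I)
  fix e :: real assume "0 < e"
  note D = L2_tendstoD[OF F]
  \<comment> \<open>Chosen to bring the second summand of \<open>norm_L2_inner_le\<close> below
    \<open>e / 2\<close>; the 1 keeps \<open>t\<close> positive when \<open>K\<close> has norm
    zero.\<close>
  define t where "t = 2 * (L2_sq K + 1) / e"
  have t: "t > 0" "L2_sq K / t < e / 2"
    using \<open>0 < e\<close> L2_sq_nonneg[of K] by (auto simp: t_def field_simps add_nonneg_pos)
  have "(\<lambda>n. t * L2_sq (\<lambda>\<omega>. F n \<omega> - G \<omega>)) \<longlonglongrightarrow> 0"
    using tendsto_mult_left[OF D(3), of t] by simp
  then have "\<forall>\<^sub>F n in sequentially. t * L2_sq (\<lambda>\<omega>. F n \<omega> - G \<omega>) < e / 2"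
    using \<open>0 < e\<close> by (intro order_tendstoD(2)) auto
  then obtain N where N: "\<And>n. n \<ge> N \<Longrightarrow> t * L2_sq (\<lambda>\<omega>. F n \<omega> - G \<omega>) < e / 2"
    by (auto simp: eventually_sequentially)
  have "norm (L2_inner (F n) K - L2_inner G K) < e" if "n \<ge> N" for n
  proof -
    have "L2_inner (F n) K - L2_inner G K = L2_inner (\<lambda>\<omega>. F n \<omega> - G \<omega>) K"
      using D K by (simp add: L2_inner_diff_left)
    then have "norm (L2_inner (F n) K - L2_inner G K) = norm (L2_inner (\<lambda>\<omega>. F n \<omega> - G \<omega>) K)"
      by (rule arg_cong)
    then show ?thesis
      using norm_L2_inner_le[OF square_integrable_diff[OF D(1,2)] K t(1), of n] N[OF that] t(2)
      by linarith
  qed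
  then show "\<exists>N. \<forall>n\<ge>N. norm (L2_inner (F n) K - L2_inner G K) < e" by blast
qed

lemma tendsto_L2_inner_right:
  assumes "L2_tendsto F G" "square_integrable K"
  shows "(\<lambda>n. L2_inner K (F n)) \<longlonglongrightarrow> L2_inner K G"
  by (subst (1 2) L2_inner_commute) (intro tendsto_cnj tendsto_L2_inner_left assms)

lemma L2_tendsto_CauchyI:
  assumes sq: "\<And>n. square_integrable (F n)"
    and Cauchy: "\<And>e. e > 0 \<Longrightarrow>
      \<exists>N. \<forall>m\<ge>N. \<forall>n\<ge>m. L2_sq (\<lambda>\<omega>. F n \<omega> - F m \<omega>) < e"
  shows "\<exists>G. L2_tendsto F G"
proof -
  obtain G where "G \<in> borel_measurable circle" "integrable circle (\<lambda>x. (norm (G x))\<^sup>2)"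
    "(\<lambda>n. LINT x|circle. (norm (F n x - G x))\<^sup>2) \<longlonglongrightarrow> 0"
  proof (rule L2_complete)
    fix e :: real assume "e > 0"
    then obtain N where N: "\<And>m n. m \<ge> N \<Longrightarrow> n \<ge> m \<Longrightarrow> L2_sq (\<lambda>\<omega>. F n \<omega> - F m \<omega>) < e"
      using Cauchy by blast
    have "(LINT x|circle. (norm (F m x - F n x))\<^sup>2) < e" if "m \<ge> N" "n \<ge> N" for m n
      using N[of m n] N[of n m] that
      by (cases "m \<le> n") (auto simp: L2_sq_def norm_minus_commute)
    then show "\<exists>N. \<forall>m\<ge>N. \<forall>n\<ge>N. (LINT x|circle. (norm (F m x - F n x))\<^sup>2) < e" by blast
  qed (use sq in \<open>auto simp: square_integrable_def\<close>)
  then show ?thesis using sq by (auto simp: L2_tendsto_def square_integrable_def)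
qed

lemma L2_sumsD:
  assumes "L2_sums u G"
  shows "square_integrable (u j)" "square_integrable G"
proof -
  have "square_integrable (\<lambda>\<omega>. (\<Sum>j<Suc j. u j \<omega>) - (\<Sum>j<j. u j \<omega>))"
    using assms unfolding L2_sums_def by (intro square_integrable_diff L2_tendstoD(1))
  then show "square_integrable (u j)" by simp
qed (use assms in \<open>auto simp: L2_sums_def intro: L2_tendstoD\<close>)

lemma L2_summableI: "L2_sums u G \<Longrightarrow> L2_summable u"
  by (auto simp: L2_summable_def)

lemma L2_sums_L2_suminf: "L2_summable u \<Longrightarrow> L2_sums u (L2_suminf u)"
  unfolding L2_summable_def L2_suminf_def by (auto intro: someI[of "L2_sums u"])

text \<open>The arbitrary choice in \<open>L2_suminf\<close> is invisible up to null sets, so the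
  proof can compute with any explicit L2 sum.\<close>

lemma L2_suminf_AE_eq: "L2_sums u G \<Longrightarrow> AE \<omega> in circle. L2_suminf u \<omega> = G \<omega>"
  using L2_sums_L2_suminf[OF L2_summableI] unfolding L2_sums_def by (rule L2_tendsto_unique)

lemma L2_sums_bounded_mult:
  assumes "B \<in> borel_measurable circle" "AE \<omega> in circle. cmod (B \<omega>) \<le> C" "L2_sums u G"
  shows "L2_sums (\<lambda>j \<omega>. B \<omega> * u j \<omega>) (\<lambda>\<omega>. B \<omega> * G \<omega>)"
  using L2_tendsto_bounded_mult[OF assms(1,2), of "\<lambda>n \<omega>. \<Sum>j<n. u j \<omega>" G] assms(3)
  by (simp add: L2_sums_def sum_distrib_left)

lemma L2_sums_cong_AE:
  assumes u: "L2_sums u G"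
    and ae: "\<And>j. AE \<omega> in circle. u j \<omega> = u' j \<omega>" "AE \<omega> in circle. G \<omega> = G' \<omega>"
    and sq: "\<And>j. square_integrable (u' j)" "square_integrable G'"
  shows "L2_sums u' G'"
  unfolding L2_sums_def
proof (rule L2_tendsto_cong_AE[OF u[unfolded L2_sums_def] _ ae(2) _ sq(2)])
  fix n
  have "AE \<omega> in circle. \<forall>j\<in>{..<n}. u j \<omega> = u' j \<omega>"
    by (rule AE_finite_allI) (auto intro: ae)
  then show "AE \<omega> in circle. (\<Sum>j<n. u j \<omega>) = (\<Sum>j<n. u' j \<omega>)"
    by eventually_elim simp
qed (auto intro: square_integrable_sum sq)

lemma sum_diff_lessThan:
  fixes f :: "nat \<Rightarrow> 'a::ab_group_add"
  shows "m \<le> n \<Longrightarrow> (\<Sum>j<n. f j) - (\<Sum>j<m. f j) = (\<Sum>j=m..<n. f j)"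
  by (simp add: lessThan_atLeast0 sum_diff_nat_ivl)

text \<open>The hypothesis bounds whole blocks rather than single terms because the terms need not
  be orthogonal; for \<open>analytic_part\<close> only a block can be compared with a product of
  known norm.\<close>

lemma L2_summable_comparison:
  assumes sq: "\<And>j. square_integrable (u j)"
    and le: "\<And>m n. m \<le> n \<Longrightarrow> L2_sq (\<lambda>\<omega>. \<Sum>j=m..<n. u j \<omega>) \<le> (\<Sum>j=m..<n. b j)"
    and b: "summable b"
  shows "L2_summable u"
proof -
  have "\<exists>G. L2_tendsto (\<lambda>n \<omega>. \<Sum>j<n. u j \<omega>) G"
  proof (rule L2_tendsto_CauchyI)
    fix e :: real assume "e > 0"
    then obtain N where N: "\<And>m n. m \<ge> N \<Longrightarrow> norm (\<Sum>j=m..<n. b j) < e"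
      using b unfolding summable_Cauchy by blast
    have "L2_sq (\<lambda>\<omega>. (\<Sum>j<n. u j \<omega>) - (\<Sum>j<m. u j \<omega>)) < e" if "m \<ge> N" "n \<ge> m" for m n
      using le[OF that(2)] N[OF that(1), of n] by (simp add: sum_diff_lessThan[OF that(2)])
    then show "\<exists>N. \<forall>m\<ge>N. \<forall>n\<ge>m. L2_sq (\<lambda>\<omega>. (\<Sum>j<n. u j \<omega>) - (\<Sum>j<m. u j \<omega>)) < e"
      by blast
  qed (intro square_integrable_sum sq)
  then show ?thesis by (simp add: L2_summable_def L2_sums_def)
qed

section \<open>Exponentials: orthogonality and synthesis from square-summable coefficients\<close>

definition expi :: "int \<Rightarrow> real \<Rightarrow> complex" where
  "expi k \<omega> = cis (of_int k * \<omega>)"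

lemma expi_measurable [measurable]: "expi k \<in> borel_measurable circle"
  unfolding expi_def[abs_def]
  by (intro borel_measurable_circle borel_measurable_continuous_onI continuous_intros)

lemma norm_expi [simp]: "cmod (expi k \<omega>) = 1"
  by (simp add: expi_def)

lemma expi_0 [simp]: "expi 0 \<omega> = 1"
  by (simp add: expi_def)

lemma expi_mult: "expi j \<omega> * expi k \<omega> = expi (j + k) \<omega>"
  by (simp add: expi_def cis_mult distrib_right)

lemma cnj_expi: "cnj (expi k \<omega>) = expi (- k) \<omega>"
  by (simp add: expi_def cis_cnj)

text \<open>Links the \<open>cis\<close> terms with natural frequencies to \<open>expi\<close>,
  whose integer frequencies are closed under conjugation and shifts to the left.\<close>

lemma expi_int: "cis (real n * \<omega>) = expi (int n) \<omega>"
  by (simp add: expi_def)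

lemma square_integrable_expi_mult:
  "square_integrable F \<Longrightarrow> square_integrable (\<lambda>\<omega>. expi k \<omega> * F \<omega>)"
  by (rule square_integrable_bounded_mult(1)[where C = 1]) auto

lemma square_integrable_expi: "square_integrable (expi k)"
  using square_integrable_expi_mult[OF square_integrable_const[of 1]] by simp

lemma integral_expi: "(LINT \<omega>|circle. expi k \<omega>) = (if k = 0 then 2 * pi else 0)"
proof -
  have int: "integrable circle (expi k)"
    using integrable_mult_cnj[OF square_integrable_expi[of k] square_integrable_expi[of 0]] by simp
  have "(LINT \<omega>|circle. expi k \<omega>) = integral {0..<2 * pi} (expi k)"
    using int unfolding circle_def by (rule lebesgue_integral_eq_integral) simp
  \<comment> \<open>The fundamental theorem of calculus needs the closed interval; the added
    endpoint is negligible.\<close>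
  also have "\<dots> = integral {0..2 * pi} (expi k)"
    by (rule integral_subset_negligible) (auto intro: negligible_subset[of "{2 * pi}"])
  also have "\<dots> = (if k = 0 then 2 * pi else 0)"
  proof (cases "k = 0")
    case True
    then have "expi k = (\<lambda>_. 1)" by (auto simp: expi_def)
    then show ?thesis using True by (simp add: scaleR_conv_of_real)
  next
    case False
    define E where "E z = exp (\<i> * of_int k * z) / (\<i> * of_int k)" for z :: complex
    have E: "E (of_real \<omega>) = expi k \<omega> / (\<i> * of_int k)" for \<omega>
      by (simp add: E_def expi_def cis_conv_exp mult_ac)
    have "(expi k has_integral E (of_real (2 * pi)) - E (of_real 0)) {0..2 * pi}"
    proof (rule fundamental_theorem_of_calculus)
      fix \<omega> :: real
      have "(E has_field_derivative exp (\<i> * of_int k * of_real \<omega>)) (at (of_real \<omega>))"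
        unfolding E_def[abs_def] using False by (auto intro!: derivative_eq_intros)
      then show "((\<lambda>\<omega>. E (of_real \<omega>)) has_vector_derivative expi k \<omega>) (at \<omega> within {0..2 * pi})"
        by (intro has_vector_derivative_real_field) (simp add: expi_def cis_conv_exp mult_ac)
    qed simp
    moreover have "expi k (2 * pi) = 1"
      using cis_multiple_2pi[of "of_int k"] by (simp add: expi_def mult_ac)
    moreover have "expi k 0 = 1" by (simp add: expi_def)
    ultimately show ?thesis
      using False by (simp only: E) (simp add: integral_unique)
  qed
  finally show ?thesis .
qed

lemma L2_inner_expi: "L2_inner (expi j) (expi k) = (if j = k then 2 * pi else 0)"
  by (simp add: L2_inner_def cnj_expi expi_mult integral_expi)

text \<open>Finite Parseval by repeated use of Pythagoras. The injective frequency map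
  \<open>p\<close> keeps distinct terms orthogonal and covers series starting at frequency 0 as well
  as at 1.\<close>

lemma L2_sq_sum_expi:
  assumes "finite A" "inj_on p A"
  shows "L2_sq (\<lambda>\<omega>. \<Sum>j\<in>A. v j * expi (p j) \<omega>) = 2 * pi * (\<Sum>j\<in>A. (cmod (v j))\<^sup>2)"
  using assms
proof (induction A rule: finite_induct)
  case empty
  then show ?case by (simp add: L2_sq_def)
next
  case (insert a A)
  have "L2_inner (\<lambda>\<omega>. v a * expi (p a) \<omega>) (\<lambda>\<omega>. \<Sum>j\<in>A. v j * expi (p j) \<omega>) = 0"
    using insert.hyps insert.prems
    by (subst L2_inner_sum_right)
       (auto simp: L2_inner_cmult_left L2_inner_cmult_right L2_inner_expi
         intro!: sum.neutral square_integrable_cmult square_integrable_expi)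
  moreover have "complex_of_real (L2_sq (\<lambda>\<omega>. v a * expi (p a) \<omega>)) = of_real (2 * pi * (cmod (v a))\<^sup>2)"
    unfolding L2_inner_self[symmetric] of_real_mult complex_norm_square
    by (simp add: L2_inner_cmult_left L2_inner_cmult_right L2_inner_expi)
  then have "L2_sq (\<lambda>\<omega>. v a * expi (p a) \<omega>) = 2 * pi * (cmod (v a))\<^sup>2"
    by (simp only: of_real_eq_iff)
  ultimately show ?case
    using insert
    by (simp add: L2_pythagoras square_integrable_sum square_integrable_cmult
        square_integrable_expi distrib_left)
qed

lemma L2_summable_expi:
  assumes "summable (\<lambda>j. (cmod (v j))\<^sup>2)" "inj p"
  shows "L2_summable (\<lambda>j \<omega>. v j * expi (p j) \<omega>)"
proof (rule L2_summable_comparison)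
  show "summable (\<lambda>j. 2 * pi * (cmod (v j))\<^sup>2)" using assms(1) by (rule summable_mult)
  show "L2_sq (\<lambda>\<omega>. \<Sum>j=m..<n. v j * expi (p j) \<omega>) \<le> (\<Sum>j=m..<n. 2 * pi * (cmod (v j))\<^sup>2)" for m n
    using inj_on_subset[OF assms(2)] by (simp add: L2_sq_sum_expi flip: sum_distrib_left)
qed (intro square_integrable_cmult square_integrable_expi)

subsection \<open>Fourier coefficients and the Hardy space\<close>

definition fcoef :: "(real \<Rightarrow> complex) \<Rightarrow> int \<Rightarrow> complex" where
  "fcoef F k = L2_inner F (expi k) / (2 * pi)"

lemma L2_inner_eq_fcoef: "L2_inner F (expi k) = 2 * pi * fcoef F k"
  by (simp add: fcoef_def)

lemma L2_inner_sum_expi: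
  fixes v :: "'a \<Rightarrow> complex"
  assumes "finite A" "inj_on p A" "i \<in> A"
  shows "L2_inner (\<lambda>\<omega>. \<Sum>j\<in>A. v j * expi (p j) \<omega>) (expi (p i)) = 2 * pi * v i"
proof -
  have "L2_inner (\<lambda>\<omega>. \<Sum>j\<in>A. v j * expi (p j) \<omega>) (expi (p i))
      = (\<Sum>j\<in>A. v j * L2_inner (expi (p j)) (expi (p i)))"
    by (subst L2_inner_sum_left)
       (auto simp: L2_inner_cmult_left intro!: square_integrable_cmult square_integrable_expi)
  also have "\<dots> = (\<Sum>j\<in>A. if j = i then 2 * pi * v i else 0)"
    using assms by (intro sum.cong refl) (auto simp: L2_inner_expi inj_on_eq_iff)
  also have "\<dots> = 2 * pi * v i" using assms by simp
  finally show ?thesis .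
qed

text \<open>Once n > i, the partial sums already have the coefficient \<open>v i\<close> at
  \<open>p i\<close>, and the inner product is continuous. So an expansion determines its
  coefficients.\<close>

lemma fcoef_L2_sums:
  fixes v :: "nat \<Rightarrow> complex"
  assumes "L2_sums (\<lambda>j \<omega>. v j * expi (p j) \<omega>) F" "inj p"
  shows "fcoef F (p i) = v i"
proof -
  have "(\<lambda>n. L2_inner (\<lambda>\<omega>. \<Sum>j<n. v j * expi (p j) \<omega>) (expi (p i))) \<longlonglongrightarrow> L2_inner F (expi (p i))"
    using assms(1) unfolding L2_sums_def by (intro tendsto_L2_inner_left square_integrable_expi)
  moreover have "(\<lambda>n. L2_inner (\<lambda>\<omega>. \<Sum>j<n. v j * expi (p j) \<omega>) (expi (p i))) \<longlonglongrightarrow> 2 * pi * v i"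
    using inj_on_subset[OF assms(2)]
    by (intro tendsto_eventually eventually_sequentiallyI[of "Suc i"])
       (simp add: L2_inner_sum_expi)
  ultimately have "L2_inner F (expi (p i)) = 2 * pi * v i" by (rule LIMSEQ_unique)
  then show ?thesis by (simp add: fcoef_def)
qed

text \<open>The orthogonal projection onto the span of e_0, ..., e_(n-1). It is one-sided, so
  convergence to \<open>F\<close> expresses the absence of negative frequencies.\<close>

definition fourier_sum :: "nat \<Rightarrow> (real \<Rightarrow> complex) \<Rightarrow> real \<Rightarrow> complex" where
  "fourier_sum n F \<omega> = (\<Sum>j<n. fcoef F (int j) * expi (int j) \<omega>)"

lemma square_integrable_fourier_sum: "square_integrable (fourier_sum n F)"
  unfolding fourier_sum_def[abs_def]
  by (intro square_integrable_sum square_integrable_cmult square_integrable_expi)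

text \<open>The residual is orthogonal to e_0, ..., e_(n-1). Two consequences matter: the
  coefficients are square-summable, and the residual is never larger than \<open>F\<close>, whatever
  n is.\<close>

lemma bessel_identity:
  assumes F: "square_integrable F"
  shows "L2_sq F = L2_sq (\<lambda>\<omega>. F \<omega> - fourier_sum n F \<omega>)
    + 2 * pi * (\<Sum>j<n. (cmod (fcoef F (int j)))\<^sup>2)"
proof -
  have "L2_inner (\<lambda>\<omega>. F \<omega> - fourier_sum n F \<omega>) (expi (int j)) = 0" if "j < n" for j
    using F that L2_inner_sum_expi[of "{..<n}" int j "\<lambda>j. fcoef F (int j)"]
    by (simp add: L2_inner_diff_left square_integrable_fourier_sum[of n F, unfolded fourier_sum_def[abs_def]]
        square_integrable_expi fourier_sum_def[abs_def] L2_inner_eq_fcoef[of F])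
  then have "L2_inner (\<lambda>\<omega>. F \<omega> - fourier_sum n F \<omega>) (fourier_sum n F) = 0"
    using F unfolding fourier_sum_def[of n F, abs_def]
    by (subst L2_inner_sum_right)
       (auto simp: L2_inner_cmult_right intro!: sum.neutral square_integrable_diff
         square_integrable_sum square_integrable_cmult square_integrable_expi)
  then have "L2_sq (\<lambda>\<omega>. (F \<omega> - fourier_sum n F \<omega>) + fourier_sum n F \<omega>)
      = L2_sq (\<lambda>\<omega>. F \<omega> - fourier_sum n F \<omega>) + L2_sq (fourier_sum n F)"
    by (intro L2_pythagoras square_integrable_diff F square_integrable_fourier_sum)
  then show ?thesis
    using L2_sq_sum_expi[of "{..<n}" int "\<lambda>j. fcoef F (int j)"]
    by (simp add: fourier_sum_def[abs_def])
qed

text \<open>The Hardy space H^2 of the circle. Asking for the coefficients of \<open>F\<close>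
  itself is no restriction: by \<open>hardyI\<close> any L2 expansion in e_j with j >= 0 has
  them.\<close>

definition hardy :: "(real \<Rightarrow> complex) \<Rightarrow> bool" where
  "hardy F \<longleftrightarrow> L2_sums (\<lambda>j \<omega>. fcoef F (int j) * expi (int j) \<omega>) F"

lemma hardy_square_integrable: "hardy F \<Longrightarrow> square_integrable F"
  unfolding hardy_def by (rule L2_sumsD)

lemma hardy_iff: "hardy F \<longleftrightarrow> L2_tendsto (\<lambda>n. fourier_sum n F) F"
  by (simp add: hardy_def L2_sums_def fourier_sum_def[abs_def])

lemma hardyI: "L2_sums (\<lambda>j \<omega>. v j * expi (int j) \<omega>) F \<Longrightarrow> hardy F"
  using fcoef_L2_sums[of v int F] by (simp add: hardy_def)

lemma hardy_fcoef_ell2: "hardy F \<Longrightarrow> (\<lambda>j. fcoef F (int j)) \<in> ell2_plus"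
  unfolding ell2_plus_def mem_Collect_eq
proof (rule summableI_nonneg_bounded)
  fix n assume "hardy F"
  then have "2 * pi * (\<Sum>j<n. (cmod (fcoef F (int j)))\<^sup>2) \<le> L2_sq F"
    using bessel_identity[OF hardy_square_integrable, of F n] L2_sq_nonneg by smt
  then show "(\<Sum>j<n. (cmod (fcoef F (int j)))\<^sup>2) \<le> L2_sq F / (2 * pi)"
    by (simp add: pos_le_divide_eq mult_ac)
qed auto

lemma hardy_expi: "k \<ge> 0 \<Longrightarrow> hardy (expi k)"
proof -
  assume "k \<ge> 0"
  then obtain i where k: "k = int i" by (metis nonneg_int_cases)
  define v where "v j = (if j = i then 1 else 0 :: complex)" for j
  have "L2_tendsto (\<lambda>n \<omega>. \<Sum>j<n. v j * expi (int j) \<omega>) (expi k)"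
    unfolding L2_tendsto_iff
  proof (intro conjI allI)
    have "(\<Sum>j<n. v j * expi (int j) \<omega>) = (\<Sum>j<n. if j = i then expi k \<omega> else 0)" for n \<omega>
      by (intro sum.cong) (auto simp: v_def k)
    then show "(\<lambda>n. L2_sq (\<lambda>\<omega>. (\<Sum>j<n. v j * expi (int j) \<omega>) - expi k \<omega>)) \<longlonglongrightarrow> 0"
      by (intro tendsto_eventually eventually_sequentiallyI[of "Suc i"]) (simp add: L2_sq_def)
  qed (intro square_integrable_sum square_integrable_cmult square_integrable_expi)+
  then show "hardy (expi k)"
    by (intro hardyI[of v]) (simp add: L2_sums_def)
qed

lemma fcoef_add:
  "square_integrable F \<Longrightarrow> square_integrable G \<Longrightarrow>
    fcoef (\<lambda>\<omega>. F \<omega> + G \<omega>) k = fcoef F k + fcoef G k"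
  by (simp add: fcoef_def L2_inner_add_left square_integrable_expi add_divide_distrib)

lemma fcoef_diff:
  "square_integrable F \<Longrightarrow> square_integrable G \<Longrightarrow>
    fcoef (\<lambda>\<omega>. F \<omega> - G \<omega>) k = fcoef F k - fcoef G k"
  by (simp add: fcoef_def L2_inner_diff_left square_integrable_expi diff_divide_distrib)

lemma fcoef_cmult: "fcoef (\<lambda>\<omega>. a * F \<omega>) k = a * fcoef F k"
  by (simp add: fcoef_def L2_inner_cmult_left)

lemma hardy_add: 
  assumes "hardy F" "hardy G" shows "hardy (\<lambda>\<omega>. F \<omega> + G \<omega>)"
proof -
  have "L2_tendsto (\<lambda>n \<omega>. fourier_sum n F \<omega> + fourier_sum n G \<omega>) (\<lambda>\<omega>. F \<omega> + G \<omega>)"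
    using assms by (intro L2_tendsto_add) (auto simp: hardy_iff)
  then show ?thesis
    using assms[THEN hardy_square_integrable]
    by (simp add: hardy_iff fourier_sum_def[abs_def] fcoef_add distrib_right sum.distrib)
qed

lemma hardy_cmult: 
  assumes "hardy F" shows "hardy (\<lambda>\<omega>. a * F \<omega>)"
  using L2_tendsto_cmult[of "\<lambda>n. fourier_sum n F" F a] assms
  by (simp add: hardy_iff fourier_sum_def[abs_def] fcoef_cmult sum_distrib_left mult.assoc)

lemma hardy_diff: "hardy F \<Longrightarrow> hardy G \<Longrightarrow> hardy (\<lambda>\<omega>. F \<omega> - G \<omega>)"
  using hardy_add[of F "\<lambda>\<omega>. -1 * G \<omega>"] hardy_cmult[of G "-1"] by simp

lemma hardy_zero: "hardy (\<lambda>\<omega>. 0)"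
  using hardy_cmult[OF hardy_expi[of 0], of 0] by simp

lemma hardy_sum: "(\<And>j. j \<in> A \<Longrightarrow> hardy (u j)) \<Longrightarrow> hardy (\<lambda>\<omega>. \<Sum>j\<in>A. u j \<omega>)"
  by (induction A rule: infinite_finite_induct) (auto intro: hardy_zero hardy_add)

text \<open>Closedness of the Hardy space. The residual of \<open>G\<close> is that of
  \<open>F k\<close> up to the residual of \<open>F k - G\<close>, which the Bessel identity bounds
  uniformly in n; hence k can be fixed before n.\<close>

lemma hardy_L2_tendsto:
  assumes F: "L2_tendsto F G" and hardy: "\<And>n. hardy (F n)"
  shows "hardy G"
  unfolding hardy_iff L2_tendsto_iff
proof (intro conjI allI)
  note D = L2_tendstoD[OF F]
  show "square_integrable G" by (rule D)
  show "square_integrable (fourier_sum n G)" for n by (rule square_integrable_fourier_sum)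
  show "(\<lambda>n. L2_sq (\<lambda>\<omega>. fourier_sum n G \<omega> - G \<omega>)) \<longlonglongrightarrow> 0"
  proof (rule LIMSEQ_I)
    \<comment> \<open>Two contributions below \<open>e / 4\<close> suffice, since
      \<open>L2_sq_add_le\<close> doubles each of them.\<close>
    fix e :: real assume "e > 0"
    have "\<forall>\<^sub>F k in sequentially. L2_sq (\<lambda>\<omega>. F k \<omega> - G \<omega>) < e / 4"
      using D(3) \<open>e > 0\<close> by (intro order_tendstoD(2)) auto
    then obtain k where k: "L2_sq (\<lambda>\<omega>. F k \<omega> - G \<omega>) < e / 4"
      by (auto simp: eventually_sequentially)
    have "\<forall>\<^sub>F n in sequentially. L2_sq (\<lambda>\<omega>. fourier_sum n (F k) \<omega> - F k \<omega>) < e / 4"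
      using hardy[of k] \<open>e > 0\<close> by (intro order_tendstoD(2)) (auto simp: hardy_iff L2_tendsto_iff)
    then obtain N where N: "\<And>n. n \<ge> N \<Longrightarrow> L2_sq (\<lambda>\<omega>. fourier_sum n (F k) \<omega> - F k \<omega>) < e / 4"
      by (auto simp: eventually_sequentially)
    have "L2_sq (\<lambda>\<omega>. fourier_sum n G \<omega> - G \<omega>) < e" if n: "n \<ge> N" for n
    proof -
      define P where "P \<omega> = F k \<omega> - G \<omega>" for \<omega>
      have P: "square_integrable P"
        unfolding P_def[abs_def] by (intro square_integrable_diff D)
      have "fourier_sum n P \<omega> = fourier_sum n (F k) \<omega> - fourier_sum n G \<omega>" for \<omega>
        using D by (simp add: P_def[abs_def] fourier_sum_def fcoef_diff left_diff_distrib sum_subtractf)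
      then have "(\<lambda>\<omega>. fourier_sum n G \<omega> - G \<omega>)
          = (\<lambda>\<omega>. (P \<omega> - fourier_sum n P \<omega>) + (fourier_sum n (F k) \<omega> - F k \<omega>))"
        by (simp add: P_def)
      then have "L2_sq (\<lambda>\<omega>. fourier_sum n G \<omega> - G \<omega>)
          \<le> 2 * L2_sq (\<lambda>\<omega>. P \<omega> - fourier_sum n P \<omega>) + 2 * L2_sq (\<lambda>\<omega>. fourier_sum n (F k) \<omega> - F k \<omega>)"
        using P D by (simp add: L2_sq_add_le square_integrable_diff square_integrable_fourier_sum)
      moreover have "L2_sq (\<lambda>\<omega>. P \<omega> - fourier_sum n P \<omega>) \<le> L2_sq P"
        using bessel_identity[OF P, of n] by (simp add: sum_nonneg)
      ultimately show ?thesis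
        using k N[OF n] by (simp add: P_def[abs_def])
    qed
    then show "\<exists>N. \<forall>n\<ge>N. norm (L2_sq (\<lambda>\<omega>. fourier_sum n G \<omega> - G \<omega>) - 0) < e"
      by (auto simp: L2_sq_nonneg)
  qed
qed

lemma hardy_L2_sums: "L2_sums u F \<Longrightarrow> (\<And>j. hardy (u j)) \<Longrightarrow> hardy F"
  unfolding L2_sums_def by (erule hardy_L2_tendsto) (intro hardy_sum)

lemma hardy_expi_mult:
  assumes F: "hardy F" and k: "k \<ge> 0"
  shows "hardy (\<lambda>\<omega>. expi k \<omega> * F \<omega>)"
proof (rule hardy_L2_sums)
  show "L2_sums (\<lambda>j \<omega>. expi k \<omega> * (fcoef F (int j) * expi (int j) \<omega>)) (\<lambda>\<omega>. expi k \<omega> * F \<omega>)"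
    using F unfolding hardy_def by (rule L2_sums_bounded_mult[where C = 1, rotated 2]) auto
  show "hardy (\<lambda>\<omega>. expi k \<omega> * (fcoef F (int j) * expi (int j) \<omega>))" for j
    using hardy_cmult[OF hardy_expi[of "k + int j"], of "fcoef F (int j)"] k
    by (simp add: mult.left_commute[of "expi k _"] expi_mult)
qed

text \<open>Expanding only \<open>K\<close> reduces the claim to \<open>F\<close> shifted by e_j
  with j >= 0. The bound on \<open>F\<close> makes multiplication by it continuous, so the expansion
  may be multiplied term by term.\<close>

lemma hardy_mult:
  assumes F: "hardy F" and K: "hardy K" and C: "AE \<omega> in circle. cmod (F \<omega>) \<le> C"
  shows "hardy (\<lambda>\<omega>. F \<omega> * K \<omega>)"
proof (rule hardy_L2_sums)
  show "L2_sums (\<lambda>j \<omega>. F \<omega> * (fcoef K (int j) * expi (int j) \<omega>)) (\<lambda>\<omega>. F \<omega> * K \<omega>)"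
    using K C square_integrable_measurable[OF hardy_square_integrable[OF F]]
    unfolding hardy_def by (intro L2_sums_bounded_mult[where C = C])
  show "hardy (\<lambda>\<omega>. F \<omega> * (fcoef K (int j) * expi (int j) \<omega>))" for j
    using hardy_cmult[OF hardy_expi_mult[OF F, of "int j"], of "fcoef K (int j)"]
    by (simp add: mult_ac)
qed

text \<open>Orthogonality to all e_j with j >= 0 is the form in which "negative frequencies only" is
  expressed; continuity extends it to their closed span.\<close>

lemma L2_inner_hardy_eq_0:
  assumes N: "square_integrable N" "\<And>j. L2_inner N (expi (int j)) = 0" and F: "hardy F"
  shows "L2_inner N F = 0"
proof (rule LIMSEQ_unique)
  show "(\<lambda>n. L2_inner N (fourier_sum n F)) \<longlonglongrightarrow> L2_inner N F"
    using F N(1) unfolding hardy_iff by (rule tendsto_L2_inner_right)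
  have "L2_inner N (fourier_sum n F) = 0" for n
    unfolding fourier_sum_def[abs_def] using N
    by (subst L2_inner_sum_right)
       (auto simp: L2_inner_cmult_right intro: square_integrable_cmult square_integrable_expi)
  then show "(\<lambda>n. L2_inner N (fourier_sum n F)) \<longlonglongrightarrow> 0" by simp
qed

subsection \<open>The Wiener--Hopf factorization\<close>

lemma square_integrable_cnj: "square_integrable F \<Longrightarrow> square_integrable (\<lambda>\<omega>. cnj (F \<omega>))"
  by (auto simp: square_integrable_def intro: borel_measurable_cnj)

lemma L2_sums_ignore_initial:
  assumes "L2_sums u G"
  shows "L2_sums (\<lambda>j. u (j + l)) (\<lambda>\<omega>. G \<omega> - (\<Sum>j<l. u j \<omega>))"
proof -
  note D = L2_tendstoD[OF assms[unfolded L2_sums_def]]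
  have "L2_tendsto (\<lambda>n \<omega>. \<Sum>j<n + l. u j \<omega>) G"
    unfolding L2_tendsto_iff using D(1,2) LIMSEQ_ignore_initial_segment[OF D(3), of l]
    by simp
  moreover have "L2_tendsto (\<lambda>n \<omega>. \<Sum>j<l. u j \<omega>) (\<lambda>\<omega>. \<Sum>j<l. u j \<omega>)"
    by (intro L2_tendsto_const square_integrable_sum L2_sumsD(1)[OF assms])
  ultimately have "L2_tendsto (\<lambda>n \<omega>. (\<Sum>j<n + l. u j \<omega>) - (\<Sum>j<l. u j \<omega>))
      (\<lambda>\<omega>. G \<omega> - (\<Sum>j<l. u j \<omega>))"
    by (rule L2_tendsto_diff)
  moreover have "(\<Sum>j<n + l. u j \<omega>) - (\<Sum>j<l. u j \<omega>) = (\<Sum>j<n. u (j + l) \<omega>)" for n \<omega>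
    using sum.shift_bounds_nat_ivl[of "\<lambda>j. u j \<omega>" 0 l n]
    by (simp only: sum_diff_lessThan[OF le_add2]) (simp add: lessThan_atLeast0 add.commute)
  ultimately show ?thesis by (simp add: L2_sums_def)
qed

lemma L2_sums_of_real_cis:
  fixes a :: "nat \<Rightarrow> real"
  assumes "summable (\<lambda>j. (a (Suc j))\<^sup>2)"
  defines "u \<equiv> \<lambda>j \<omega>. of_real (a (Suc j)) * cis (real (Suc j) * \<omega>)"
  shows "L2_sums u (L2_suminf u)"
proof (rule L2_sums_L2_suminf)
  have "L2_summable (\<lambda>j \<omega>. of_real (a (Suc j)) * expi (int (Suc j)) \<omega>)"
    by (rule L2_summable_expi) (use assms in \<open>auto simp: inj_on_def\<close>)
  then show "L2_summable u" by (simp only: u_def expi_int)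
qed

lemma hardy_of_real_cis:
  fixes a :: "nat \<Rightarrow> real"
  assumes "summable (\<lambda>j. (a (Suc j))\<^sup>2)"
  shows "hardy (L2_suminf (\<lambda>j \<omega>. of_real (a (Suc j)) * cis (real (Suc j) * \<omega>)))"
  using L2_sums_of_real_cis[OF assms]
  by (rule hardy_L2_sums) (unfold expi_int, intro hardy_cmult hardy_expi, simp)

lemma hardy_psi_fun: "summable (\<lambda>j. (\<psi> (Suc j))\<^sup>2) \<Longrightarrow> hardy (psi_fun \<psi>)"
  unfolding psi_fun_def[abs_def]
  using hardy_add[OF hardy_expi[of 0] hardy_of_real_cis[of \<psi>]] by simp

lemma hardy_phi_fun: "summable (\<lambda>j. (\<phi> (Suc j))\<^sup>2) \<Longrightarrow> hardy (phi_fun \<phi>)"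
  unfolding phi_fun_def[abs_def]
  using hardy_diff[OF hardy_expi[of 0] hardy_of_real_cis[of \<phi>]] by simp

lemma L2_sums_phi_tail:
  assumes "summable (\<lambda>j. (\<phi> (Suc j))\<^sup>2)"
  shows "L2_sums (\<lambda>s \<omega>. of_real (\<phi> (l + Suc s)) * cis (real (Suc s) * \<omega>)) (phi_tail \<phi> l)"
  unfolding phi_tail_def[abs_def]
  using L2_sums_of_real_cis[of "\<lambda>j. \<phi> (l + j)"] summable_ignore_initial_segment[OF assms, of l]
  by (simp add: add_ac)

text \<open>Multiplication by e_(-l) moves frequency s to s - l: the terms with s <= l stay
  explicit, the others are exactly the series of \<open>phi_tail\<close>. This is the conjugate of
  the splitting that is wanted, proved where the defining series live. \<open>phi_fun\<close> and
  \<open>phi_tail\<close> rest on separately chosen representatives, hence the null set.\<close>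

lemma expi_mult_phi_fun:
  assumes \<phi>: "summable (\<lambda>j. (\<phi> (Suc j))\<^sup>2)"
  shows "AE \<omega> in circle. expi (- int l) \<omega> * phi_fun \<phi> \<omega> =
    expi (- int l) \<omega> - (\<Sum>s=1..l. of_real (\<phi> s) * expi (int s - int l) \<omega>) - phi_tail \<phi> l \<omega>"
proof -
  define u where "u j \<omega> = of_real (\<phi> (Suc j)) * cis (real (Suc j) * \<omega>)" for j \<omega>
  have shift: "expi (- int l) \<omega> * u j \<omega> = of_real (\<phi> (Suc j)) * expi (int (Suc j) - int l) \<omega>" for j \<omega>
    unfolding u_def expi_int by (simp add: mult.left_commute[of "expi (- int l) _"] expi_mult)
  have "L2_sums u (L2_suminf u)"
    unfolding u_def[abs_def] by (rule L2_sums_of_real_cis[OF \<phi>])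
  then have "L2_sums (\<lambda>j \<omega>. expi (- int l) \<omega> * u j \<omega>) (\<lambda>\<omega>. expi (- int l) \<omega> * L2_suminf u \<omega>)"
    by (rule L2_sums_bounded_mult[where C = 1, rotated 2]) auto
  then have "L2_sums (\<lambda>j \<omega>. expi (- int l) \<omega> * u (j + l) \<omega>)
      (\<lambda>\<omega>. expi (- int l) \<omega> * L2_suminf u \<omega> - (\<Sum>j<l. expi (- int l) \<omega> * u j \<omega>))"
    by (rule L2_sums_ignore_initial)
  moreover have "L2_sums (\<lambda>j \<omega>. expi (- int l) \<omega> * u (j + l) \<omega>) (phi_tail \<phi> l)"
    using L2_sums_phi_tail[OF \<phi>, of l] unfolding shift expi_int by (simp add: add_ac)
  ultimately have "AE \<omega> in circle. expi (- int l) \<omega> * L2_suminf u \<omega>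
      - (\<Sum>j<l. expi (- int l) \<omega> * u j \<omega>) = phi_tail \<phi> l \<omega>"
    unfolding L2_sums_def by (rule L2_tendsto_unique)
  then show ?thesis
  proof eventually_elim
    case (elim \<omega>)
    have "(\<Sum>j<l. expi (- int l) \<omega> * u j \<omega>) = (\<Sum>s=1..l. of_real (\<phi> s) * expi (int s - int l) \<omega>)"
      unfolding shift
      using sum.atLeast1_atMost_eq[of "\<lambda>s. of_real (\<phi> s) * expi (int s - int l) \<omega>" l] by simp
    then show ?case
      using elim by (simp add: phi_fun_def u_def[abs_def] algebra_simps)
  qed
qed

text \<open>$u_l$, the projection of $\phi^* e_l$ onto the non-negative frequencies.\<close>

definition analytic_part :: "(nat \<Rightarrow> real) \<Rightarrow> nat \<Rightarrow> real \<Rightarrow> complex" where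
  "analytic_part \<phi> l \<omega> =
     cis (real l * \<omega>) - (\<Sum>s=1..l. of_real (\<phi> s) * cis (real (l - s) * \<omega>))"

lemma hardy_analytic_part: "hardy (analytic_part \<phi> l)"
  unfolding analytic_part_def[abs_def] expi_int
  by (intro hardy_diff hardy_sum hardy_cmult hardy_expi) auto

lemma cnj_phi_fun_mult_expi:
  assumes \<phi>: "summable (\<lambda>j. (\<phi> (Suc j))\<^sup>2)"
  shows "AE \<omega> in circle. cnj (phi_fun \<phi> \<omega>) * expi (int l) \<omega>
    = analytic_part \<phi> l \<omega> - cnj (phi_tail \<phi> l \<omega>)"
  using expi_mult_phi_fun[OF \<phi>, of l]
proof eventually_elim
  case (elim \<omega>)
  have "cnj (phi_fun \<phi> \<omega>) * expi (int l) \<omega> = cnj (expi (- int l) \<omega> * phi_fun \<phi> \<omega>)"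
    by (simp add: cnj_expi)
  also have "\<dots> = expi (int l) \<omega> - (\<Sum>s=1..l. of_real (\<phi> s) * expi (int l - int s) \<omega>)
      - cnj (phi_tail \<phi> l \<omega>)"
    unfolding elim by (simp add: cnj_expi)
  \<comment> \<open>The natural subtraction \<open>l - s\<close> in \<open>analytic_part\<close> is
    exact because s <= l.\<close>
  also have "\<dots> = analytic_part \<phi> l \<omega> - cnj (phi_tail \<phi> l \<omega>)"
    by (simp add: analytic_part_def expi_def of_nat_diff)
  finally show ?case .
qed

text \<open>The frequencies of \<open>phi_tail\<close> start at 1 and not at 0, so none of them
  equals -j with j >= 0.\<close>

lemma L2_inner_cnj_phi_tail:
  assumes \<phi>: "summable (\<lambda>j. (\<phi> (Suc j))\<^sup>2)"
  shows "L2_inner (\<lambda>\<omega>. cnj (phi_tail \<phi> l \<omega>)) (expi (int j)) = 0"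
proof -
  note S = L2_sums_phi_tail[OF \<phi>, of l, unfolded expi_int]
  have "(\<lambda>n. L2_inner (\<lambda>\<omega>. \<Sum>s<n. of_real (\<phi> (l + Suc s)) * expi (int (Suc s)) \<omega>) (expi (- int j)))
      \<longlonglongrightarrow> L2_inner (phi_tail \<phi> l) (expi (- int j))"
    using S unfolding L2_sums_def by (intro tendsto_L2_inner_left square_integrable_expi)
  moreover have "L2_inner (\<lambda>\<omega>. \<Sum>s<n. of_real (\<phi> (l + Suc s)) * expi (int (Suc s)) \<omega>) (expi (- int j)) = 0"
    for n
    by (subst L2_inner_sum_left)
       (auto simp: L2_inner_cmult_left L2_inner_expi
         intro!: sum.neutral square_integrable_cmult square_integrable_expi)
  ultimately have "L2_inner (phi_tail \<phi> l) (expi (- int j)) = 0"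
    by (simp add: LIMSEQ_const_iff)
  moreover have "L2_inner (\<lambda>\<omega>. cnj (phi_tail \<phi> l \<omega>)) (expi (int j))
      = cnj (L2_inner (phi_tail \<phi> l) (expi (- int j)))"
    by (simp add: L2_inner_def cnj_expi flip: Bochner_Integration.integral_cnj)
  ultimately show ?thesis by simp
qed

text \<open>Yields the projection of \<open>cnj \<phi>\<close> G together with its series:
  \<open>K\<close> is in the Hardy space and the remainder is orthogonal to it, which determines
  \<open>K\<close> up to a null set.\<close>

lemma L2_sums_analytic_part:
  assumes \<phi>: "summable (\<lambda>j. (\<phi> (Suc j))\<^sup>2)"
    and C: "AE \<omega> in circle. cmod (phi_fun \<phi> \<omega>) \<le> C"
    and g: "g \<in> ell2_plus" and G: "L2_sums (\<lambda>l \<omega>. g l * expi (int l) \<omega>) G"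
  shows "\<exists>K. L2_sums (\<lambda>l \<omega>. g l * analytic_part \<phi> l \<omega>) K \<and> hardy K \<and>
    (\<forall>j. L2_inner (\<lambda>\<omega>. cnj (phi_fun \<phi> \<omega>) * G \<omega> - K \<omega>) (expi (int j)) = 0)"
proof -
  note sq = square_integrable_add square_integrable_diff square_integrable_cmult square_integrable_sum
    square_integrable_expi hardy_square_integrable[OF hardy_analytic_part]
    square_integrable_cnj L2_sumsD(2)[OF L2_sums_phi_tail[OF \<phi>]]
  have B: "(\<lambda>\<omega>. cnj (phi_fun \<phi> \<omega>)) \<in> borel_measurable circle"
    "AE \<omega> in circle. cmod (cnj (phi_fun \<phi> \<omega>)) \<le> C"
    using C hardy_square_integrable[OF hardy_phi_fun[OF \<phi>]]
    by (auto intro: borel_measurable_cnj square_integrable_measurable)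
  \<comment> \<open>\<open>U\<close> collects the non-negative and \<open>N\<close> the negative
    frequencies of \<open>P\<close>; the sign goes into \<open>h\<close> so that \<open>P\<close> is
    their sum. Finite sets \<open>A\<close> serve both the blocks in the convergence proof and the
    initial segments in the limit.\<close>
  define U where "U A \<omega> = (\<Sum>l\<in>A. g l * analytic_part \<phi> l \<omega>)" for A \<omega>
  define h where "h l = - g l" for l
  define N where "N A \<omega> = (\<Sum>l\<in>A. h l * cnj (phi_tail \<phi> l \<omega>))" for A \<omega>
  define P where "P A \<omega> = cnj (phi_fun \<phi> \<omega>) * (\<Sum>l\<in>A. g l * expi (int l) \<omega>)" for A \<omega>
  have hardy_U: "hardy (U A)" for A
    unfolding U_def[abs_def] by (intro hardy_sum hardy_cmult hardy_analytic_part)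
  have sq_N: "square_integrable (N A)" for A
    unfolding N_def[abs_def] by (intro sq)
  have sq_P: "square_integrable (P A)" for A
    unfolding P_def[abs_def] by (intro square_integrable_bounded_mult(1)[OF B] sq)
  have N_orth: "L2_inner (N A) (expi (int j)) = 0" for A j
    unfolding N_def[abs_def]
    by (subst L2_inner_sum_left)
       (auto simp: L2_inner_cmult_left L2_inner_cnj_phi_tail[OF \<phi>] intro!: sum.neutral sq)
  have P_eq: "AE \<omega> in circle. P A \<omega> = U A \<omega> + N A \<omega>" if "finite A" for A
  proof -
    have "AE \<omega> in circle. \<forall>l\<in>A. cnj (phi_fun \<phi> \<omega>) * expi (int l) \<omega>
        = analytic_part \<phi> l \<omega> - cnj (phi_tail \<phi> l \<omega>)"
      using that by (intro AE_finite_allI cnj_phi_fun_mult_expi[OF \<phi>])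
    then show ?thesis
    proof eventually_elim
      case (elim \<omega>)
      have "P A \<omega> = (\<Sum>l\<in>A. g l * (cnj (phi_fun \<phi> \<omega>) * expi (int l) \<omega>))"
        by (simp add: P_def sum_distrib_left mult.left_commute)
      also have "\<dots> = (\<Sum>l\<in>A. g l * analytic_part \<phi> l \<omega> + h l * cnj (phi_tail \<phi> l \<omega>))"
        using elim by (intro sum.cong) (auto simp: h_def right_diff_distrib)
      also have "\<dots> = U A \<omega> + N A \<omega>"
        unfolding U_def N_def by (rule sum.distrib)
      finally show ?case .
    qed
  qed
  have "L2_summable (\<lambda>l \<omega>. g l * analytic_part \<phi> l \<omega>)"
  proof (rule L2_summable_comparison)
    show "summable (\<lambda>l. C\<^sup>2 * (2 * pi * (cmod (g l))\<^sup>2))"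
      using g by (intro summable_mult) (simp add: ell2_plus_def)
    fix m n :: nat
    \<comment> \<open>Orthogonality lets \<open>N\<close> be dropped at no cost, and
      \<open>P\<close> is \<open>cnj \<phi>\<close> times a sum of orthogonal exponentials, whose
      norm is explicit.\<close>
    have "L2_inner (U {m..<n}) (N {m..<n}) = 0"
      using L2_inner_hardy_eq_0[OF sq_N N_orth hardy_U] L2_inner_commute by (metis complex_cnj_zero)
    then have "L2_sq (\<lambda>\<omega>. U {m..<n} \<omega> + N {m..<n} \<omega>) = L2_sq (U {m..<n}) + L2_sq (N {m..<n})"
      by (intro L2_pythagoras hardy_square_integrable[OF hardy_U] sq_N)
    moreover have "L2_sq (P {m..<n}) = L2_sq (\<lambda>\<omega>. U {m..<n} \<omega> + N {m..<n} \<omega>)"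
      by (intro L2_sq_cong_AE P_eq sq_P sq_N square_integrable_add hardy_square_integrable[OF hardy_U])
         simp
    ultimately have "L2_sq (U {m..<n}) \<le> L2_sq (P {m..<n})"
      using L2_sq_nonneg[of "N {m..<n}"] by simp
    also have "\<dots> \<le> C\<^sup>2 * L2_sq (\<lambda>\<omega>. \<Sum>l=m..<n. g l * expi (int l) \<omega>)"
      unfolding P_def[abs_def] by (intro square_integrable_bounded_mult(2)[OF B] sq)
    also have "\<dots> = (\<Sum>l=m..<n. C\<^sup>2 * (2 * pi * (cmod (g l))\<^sup>2))"
      using L2_sq_sum_expi[of "{m..<n}" int g] by (simp add: sum_distrib_left)
    finally show "L2_sq (\<lambda>\<omega>. \<Sum>l=m..<n. g l * analytic_part \<phi> l \<omega>) \<le> \<dots>"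
      by (simp add: U_def[abs_def])
  qed (intro sq)
  then obtain K where K: "L2_sums (\<lambda>l \<omega>. g l * analytic_part \<phi> l \<omega>) K"
    by (auto simp: L2_summable_def)
  moreover have "hardy K"
    using K by (rule hardy_L2_sums) (intro hardy_cmult hardy_analytic_part)
  moreover have "L2_inner (\<lambda>\<omega>. cnj (phi_fun \<phi> \<omega>) * G \<omega> - K \<omega>) (expi (int j)) = 0" for j
  proof -
    \<comment> \<open>The partial residuals \<open>P - U\<close> agree with \<open>N\<close> almost
      everywhere, so they are orthogonal to e_j, and the limit inherits this.\<close>
    have "L2_tendsto (\<lambda>n \<omega>. P {..<n} \<omega> - U {..<n} \<omega>) (\<lambda>\<omega>. cnj (phi_fun \<phi> \<omega>) * G \<omega> - K \<omega>)"
      unfolding P_def U_def using K G unfolding L2_sums_def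
      by (intro L2_tendsto_diff L2_tendsto_bounded_mult[OF B])
    then have "(\<lambda>n. L2_inner (\<lambda>\<omega>. P {..<n} \<omega> - U {..<n} \<omega>) (expi (int j)))
        \<longlonglongrightarrow> L2_inner (\<lambda>\<omega>. cnj (phi_fun \<phi> \<omega>) * G \<omega> - K \<omega>) (expi (int j))"
      by (intro tendsto_L2_inner_left square_integrable_expi)
    moreover have "L2_inner (\<lambda>\<omega>. P {..<n} \<omega> - U {..<n} \<omega>) (expi (int j)) = 0" for n
    proof -
      have "L2_inner (\<lambda>\<omega>. P {..<n} \<omega> - U {..<n} \<omega>) (expi (int j)) = L2_inner (N {..<n}) (expi (int j))"
      proof (rule L2_inner_cong_AE)
        show "AE \<omega> in circle. P {..<n} \<omega> - U {..<n} \<omega> = N {..<n} \<omega>"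
          using P_eq[of "{..<n}"] by (rule AE_mp) auto
      qed (intro sq_N square_integrable_expi square_integrable_diff sq_P
          hardy_square_integrable[OF hardy_U])+
      then show ?thesis by (simp add: N_orth)
    qed
    ultimately show ?thesis by (simp add: LIMSEQ_const_iff)
  qed
  ultimately show ?thesis by blast
qed

section \<open>The Toeplitz system as a condition on Fourier coefficients\<close>

lemma fcoef_fourier_transform:
  assumes "fourier_transform c f"
  shows "fcoef (\<lambda>\<omega>. of_real (f \<omega>)) k = of_real (c k)"
proof -
  \<comment> \<open>\<open>id\<close> is written out as the frequency map so that
    \<open>L2_inner_sum_expi\<close> applies.\<close>
  define S where "S n \<omega> = (\<Sum>r\<in>{- int n..int n}. of_real (c r) * expi (id r) \<omega>)" for n \<omega>
  have "L2_tendsto S (\<lambda>\<omega>. of_real (f \<omega>))"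
    using assms by (simp add: fourier_transform_def S_def[abs_def] expi_def)
  then have "(\<lambda>n. L2_inner (S n) (expi k)) \<longlonglongrightarrow> L2_inner (\<lambda>\<omega>. of_real (f \<omega>)) (expi k)"
    by (intro tendsto_L2_inner_left square_integrable_expi)
  moreover have "(\<lambda>n. L2_inner (S n) (expi k)) \<longlonglongrightarrow> 2 * pi * of_real (c k)"
  proof (intro tendsto_eventually eventually_sequentiallyI[of "nat \<bar>k\<bar>"])
    fix n assume "nat \<bar>k\<bar> \<le> n"
    then have "k \<in> {- int n..int n}" by auto
    then show "L2_inner (S n) (expi k) = 2 * pi * of_real (c k)"
      using L2_inner_sum_expi[of "{- int n..int n}" id k "\<lambda>r. of_real (c r)"]
      by (simp add: S_def[abs_def])
  qed
  ultimately have "L2_inner (\<lambda>\<omega>. of_real (f \<omega>)) (expi k) = 2 * pi * of_real (c k)"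
    by (rule LIMSEQ_unique)
  then show ?thesis by (simp add: fcoef_def)
qed

text \<open>c(l - j) is the coefficient of f e_j at frequency l, so T(f) multiplies by f and reads
  off the coefficients l >= 0. The form with \<open>sums\<close> also gives convergence of each row,
  which the \<open>suminf\<close> in \<open>toeplitz\<close> leaves open.\<close>

lemma toeplitz_sums:
  assumes f: "fourier_transform c f" "f \<in> borel_measurable circle" "AE \<omega> in circle. \<bar>f \<omega>\<bar> \<le> M"
    and X: "L2_sums (\<lambda>j \<omega>. x j * expi (int j) \<omega>) X"
  shows "(\<lambda>j. x j * of_real (c (int l - int j))) sums fcoef (\<lambda>\<omega>. of_real (f \<omega>) * X \<omega>) (int l)"
proof -
  have B: "(\<lambda>\<omega>. complex_of_real (f \<omega>)) \<in> borel_measurable circle"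
    "AE \<omega> in circle. cmod (of_real (f \<omega>)) \<le> M"
    using f by auto
  note sq = square_integrable_bounded_mult(1)[OF B] square_integrable_cmult square_integrable_expi
  have "L2_tendsto (\<lambda>n \<omega>. \<Sum>j<n. of_real (f \<omega>) * (x j * expi (int j) \<omega>)) (\<lambda>\<omega>. of_real (f \<omega>) * X \<omega>)"
    using L2_sums_bounded_mult[OF B X] by (simp only: L2_sums_def)
  then have "(\<lambda>n. L2_inner (\<lambda>\<omega>. \<Sum>j<n. of_real (f \<omega>) * (x j * expi (int j) \<omega>)) (expi (int l)))
      \<longlonglongrightarrow> L2_inner (\<lambda>\<omega>. of_real (f \<omega>) * X \<omega>) (expi (int l))"
    by (intro tendsto_L2_inner_left square_integrable_expi)
  then have lim: "(\<lambda>n. fcoef (\<lambda>\<omega>. \<Sum>j<n. of_real (f \<omega>) * (x j * expi (int j) \<omega>)) (int l))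
      \<longlonglongrightarrow> fcoef (\<lambda>\<omega>. of_real (f \<omega>) * X \<omega>) (int l)"
    unfolding fcoef_def by (intro tendsto_intros) auto
  have "L2_inner (\<lambda>\<omega>. of_real (f \<omega>) * (x j * expi (int j) \<omega>)) (expi (int l))
      = 2 * pi * (x j * of_real (c (int l - int j)))" for j
  proof -
    have "L2_inner (\<lambda>\<omega>. of_real (f \<omega>) * (x j * expi (int j) \<omega>)) (expi (int l))
        = x j * L2_inner (\<lambda>\<omega>. of_real (f \<omega>)) (expi (int l - int j))"
      by (simp add: L2_inner_def mult.left_commute[of "of_real (f _)" "x j"] mult.assoc cnj_expi expi_mult)
    then show ?thesis
      by (simp add: L2_inner_eq_fcoef fcoef_fourier_transform[OF f(1)])
  qed
  then have "fcoef (\<lambda>\<omega>. \<Sum>j<n. of_real (f \<omega>) * (x j * expi (int j) \<omega>)) (int l)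
      = (\<Sum>j<n. x j * of_real (c (int l - int j)))" for n
    unfolding fcoef_def by (subst L2_inner_sum_left) (auto intro!: sq simp flip: sum_distrib_left)
  with lim show ?thesis by (simp add: sums_def)
qed

text \<open>Coercivity of T(f): f D is orthogonal to the closed span containing D, yet its inner
  product with D is at least m times the squared norm of D.\<close>

lemma hardy_eq_0_if_toeplitz_eq_0:
  assumes f: "f \<in> borel_measurable circle" "AE \<omega> in circle. \<bar>f \<omega>\<bar> \<le> M"
    and m: "AE \<omega> in circle. m \<le> f \<omega>" "m > 0"
    and D: "hardy D" and zero: "\<And>l. fcoef (\<lambda>\<omega>. of_real (f \<omega>) * D \<omega>) (int l) = 0"
  shows "AE \<omega> in circle. D \<omega> = 0"
proof -
  have sq_D: "square_integrable D" using D by (rule hardy_square_integrable)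
  have sq: "square_integrable (\<lambda>\<omega>. of_real (f \<omega>) * D \<omega>)"
    using f by (intro square_integrable_bounded_mult(1)[OF _ _ sq_D, of _ M]) auto
  have int: "integrable circle (\<lambda>\<omega>. of_real (f \<omega>) * D \<omega> * cnj (D \<omega>))"
    by (rule integrable_mult_cnj[OF sq sq_D])
  have "m * L2_sq D = (LINT \<omega>|circle. m * (cmod (D \<omega>))\<^sup>2)"
    by (simp add: L2_sq_def)
  also have "\<dots> \<le> (LINT \<omega>|circle. Re (of_real (f \<omega>) * D \<omega> * cnj (D \<omega>)))"
  proof (rule integral_mono_AE)
    show "AE \<omega> in circle. m * (cmod (D \<omega>))\<^sup>2 \<le> Re (of_real (f \<omega>) * D \<omega> * cnj (D \<omega>))"
      using m(1)
    proof eventually_elim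
      case (elim \<omega>)
      have "of_real (f \<omega>) * D \<omega> * cnj (D \<omega>) = of_real (f \<omega> * (cmod (D \<omega>))\<^sup>2)"
        by (simp only: of_real_mult complex_norm_square mult.assoc)
      then show ?case
        using elim by (simp only: Re_complex_of_real) (simp add: mult_right_mono)
    qed
    show "integrable circle (\<lambda>\<omega>. m * (cmod (D \<omega>))\<^sup>2)"
      using square_integrable_integrable[OF sq_D] by simp
    show "integrable circle (\<lambda>\<omega>. Re (of_real (f \<omega>) * D \<omega> * cnj (D \<omega>)))"
      by (rule integrable_Re[OF int])
  qed
  also have "\<dots> = Re (L2_inner (\<lambda>\<omega>. of_real (f \<omega>) * D \<omega>) D)"
    unfolding L2_inner_def by (rule integral_Re[OF int])
  also have "L2_inner (\<lambda>\<omega>. of_real (f \<omega>) * D \<omega>) D = 0"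
    by (rule L2_inner_hardy_eq_0[OF sq _ D]) (simp add: L2_inner_eq_fcoef zero)
  finally have "L2_sq D = 0"
    using m(2) L2_sq_nonneg[of D] by (simp add: mult_le_0_iff)
  then show ?thesis by (rule L2_sq_eq_0_imp[OF sq_D])
qed

text \<open>The essential bounds are extended reals; real numbers chosen strictly beyond them spare
  a proof that they are finite.\<close>

lemma ess_bounds:
  assumes "0 < ess_inf f" "ess_sup f < \<infinity>"
  obtains m M where "m > 0" "AE \<omega> in circle. m \<le> f \<omega> \<and> f \<omega> \<le> M"
proof -
  obtain m where m: "0 < ereal m" "ereal m < ess_inf f"
    using ereal_dense2[OF assms(1)] by blast
  obtain M where M: "ess_sup f < ereal M"
    using ereal_dense2[OF assms(2)] by blast
  have "AE \<omega> in circle. m \<le> f \<omega> \<and> f \<omega> \<le> M"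
    using esssup_AE[of "\<lambda>\<omega>. ereal (f \<omega>)" circle] esssup_AE[of "\<lambda>\<omega>. - ereal (f \<omega>)" circle]
  proof eventually_elim
    case (elim \<omega>)
    have "ereal (f \<omega>) < ereal M"
      using elim(1) M unfolding ess_sup_def by (rule le_less_trans)
    moreover have "ess_inf f \<le> ereal (f \<omega>)"
      using elim(2) unfolding ess_inf_def by (simp add: ereal_uminus_le_reorder)
    then have "ereal m < ereal (f \<omega>)" using m(2) by (rule less_le_trans[rotated])
    ultimately show ?case by simp
  qed
  then show thesis using that m(1) by auto
qed

text \<open>\<open>toeplitz_inv\<close> and \<open>L2_suminf\<close> are choices that say nothing
  when a preimage or a limit is missing. The conclusion therefore also asserts that \<open>h\<close>
  is the only square-summable solution with convergent rows and that every series is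
  L2-summable.\<close>

theorem theorem2p2:
  fixes c :: "int \<Rightarrow> real" and f :: "real \<Rightarrow> real"
    and s2 :: real and \<psi> \<phi> :: "nat \<Rightarrow> real"
    and g h :: "nat \<Rightarrow> complex" and H :: "real \<Rightarrow> complex"
  assumes sym: "\<And>r. c (- r) = c r"
    and pos_def: "pos_def_seq c"
    and fourier: "fourier_transform c f"
    and inf_f: "0 < ess_inf f" and sup_f: "ess_sup f < \<infinity>"
    and factorization: "spectral_factorization f s2 \<psi> \<phi>"
    and g: "g \<in> ell2_plus"
    and h: "h = toeplitz_inv c g"
    and H: "H = L2_suminf (\<lambda>j \<omega>. h j * cis (real j * \<omega>))"
  shows "h \<in> ell2_plus \<and>
    {x \<in> ell2_plus. \<forall>l. (\<lambda>j. x j * of_real (c (int l - int j))) sums g l} = {h} \<and>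
    L2_summable (\<lambda>j \<omega>. h j * cis (real j * \<omega>)) \<and>
    L2_summable (\<lambda>l \<omega>. g l * (cis (real l * \<omega>) + cnj (psi_fun \<psi> \<omega>) * cnj (phi_tail \<phi> l \<omega>))) \<and>
    (AE \<omega> in circle. H \<omega> =
       L2_suminf (\<lambda>l \<omega>. g l * (cis (real l * \<omega>) + cnj (psi_fun \<psi> \<omega>) * cnj (phi_tail \<phi> l \<omega>))) \<omega>
         / of_real (f \<omega>)) \<and>
    L2_summable (\<lambda>l \<omega>. g l * (cis (real l * \<omega>)
       - (\<Sum>s=1..l. of_real (\<phi> s) * cis (real (l - s) * \<omega>)))) \<and>
    (AE \<omega> in circle. H \<omega> = of_real (inverse s2) * phi_fun \<phi> \<omega> *
       L2_suminf (\<lambda>l \<omega>. g l * (cis (real l * \<omega>)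
         - (\<Sum>s=1..l. of_real (\<phi> s) * cis (real (l - s) * \<omega>)))) \<omega>)"
proof -
  have s2: "s2 > 0"
    and \<psi>: "summable (\<lambda>j. (\<psi> (Suc j))\<^sup>2)" and \<phi>: "summable (\<lambda>j. (\<phi> (Suc j))\<^sup>2)"
    and inv_ae: "AE \<omega> in circle. phi_fun \<phi> \<omega> = inverse (psi_fun \<psi> \<omega>)"
    and f_psi: "AE \<omega> in circle. f \<omega> = s2 * (cmod (psi_fun \<psi> \<omega>))\<^sup>2"
    and f_phi: "AE \<omega> in circle. f \<omega> = s2 / (cmod (phi_fun \<phi> \<omega>))\<^sup>2"
    using factorization by (auto simp: spectral_factorization_def)
  obtain m M where m: "m > 0" and mM: "AE \<omega> in circle. m \<le> f \<omega> \<and> f \<omega> \<le> M"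
    using ess_bounds[OF inf_f sup_f] .
  have "square_integrable (\<lambda>\<omega>. of_real (f \<omega>))"
    using fourier unfolding fourier_transform_def by (rule L2_tendstoD)
  then have "(\<lambda>\<omega>. Re (of_real (f \<omega>))) \<in> borel_measurable circle"
    by (intro measurable_compose[OF _ borel_measurable_Re] square_integrable_measurable)
  then have f_meas [measurable]: "f \<in> borel_measurable circle" by simp
  have f_abs: "AE \<omega> in circle. \<bar>f \<omega>\<bar> \<le> M"
    using mM by eventually_elim (use m in auto)
  have f_ge: "AE \<omega> in circle. m \<le> f \<omega>"
    using mM by eventually_elim simp
  have f_bdd: "(\<lambda>\<omega>. complex_of_real (f \<omega>)) \<in> borel_measurable circle"
    "AE \<omega> in circle. cmod (of_real (f \<omega>)) \<le> M"
    using f_abs by auto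

  have hardy_psi: "hardy (psi_fun \<psi>)" and hardy_phi: "hardy (phi_fun \<phi>)"
    by (rule hardy_psi_fun[OF \<psi>], rule hardy_phi_fun[OF \<phi>])
  \<comment> \<open>The constants come from s2 |\<psi>|^2 = f <= M and s2 / |\<phi>|^2 = f >=
    m.\<close>
  define Cp where "Cp = sqrt (M / s2)"
  define Cf where "Cf = sqrt (s2 / m)"
  have psi_bdd: "AE \<omega> in circle. cmod (psi_fun \<psi> \<omega>) \<le> Cp"
    using f_psi mM
  proof eventually_elim
    case (elim \<omega>)
    then have "(cmod (psi_fun \<psi> \<omega>))\<^sup>2 \<le> M / s2"
      using s2 by (simp add: pos_le_divide_eq mult.commute)
    then show ?case unfolding Cp_def by (rule real_le_rsqrt)
  qed
  have phi_bdd: "AE \<omega> in circle. cmod (phi_fun \<phi> \<omega>) \<le> Cf"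
    using f_phi mM
  proof eventually_elim
    case (elim \<omega>)
    \<comment> \<open>At a zero of \<phi> the quotient would be 0 by convention, contradicting f >=
      m > 0.\<close>
    then have "phi_fun \<phi> \<omega> \<noteq> 0" using m by auto
    then have "s2 = f \<omega> * (cmod (phi_fun \<phi> \<omega>))\<^sup>2"
      using elim(1) by (simp add: field_simps)
    then have "(cmod (phi_fun \<phi> \<omega>))\<^sup>2 \<le> s2 / m"
      using elim(2) m by (simp add: pos_le_divide_eq mult.commute mult_right_mono)
    then show ?case unfolding Cf_def by (rule real_le_rsqrt)
  qed
  have psi_phi: "AE \<omega> in circle. psi_fun \<psi> \<omega> * phi_fun \<phi> \<omega> = 1"
    using inv_ae f_psi mM
  proof eventually_elim
    case (elim \<omega>)
    \<comment> \<open>A zero of \<psi> would give f = 0; excluding it makes \<open>inverse\<close> a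
      genuine reciprocal.\<close>
    then have "psi_fun \<psi> \<omega> \<noteq> 0" using m by auto
    then show ?case using elim by simp
  qed
  have cnj_psi_bdd: "(\<lambda>\<omega>. cnj (psi_fun \<psi> \<omega>)) \<in> borel_measurable circle"
    "AE \<omega> in circle. cmod (cnj (psi_fun \<psi> \<omega>)) \<le> Cp"
    using psi_bdd hardy_square_integrable[OF hardy_psi]
    by (auto intro: borel_measurable_cnj square_integrable_measurable)
  have cnj_phi_bdd: "(\<lambda>\<omega>. cnj (phi_fun \<phi> \<omega>)) \<in> borel_measurable circle"
    "AE \<omega> in circle. cmod (cnj (phi_fun \<phi> \<omega>)) \<le> Cf"
    using phi_bdd hardy_square_integrable[OF hardy_phi]
    by (auto intro: borel_measurable_cnj square_integrable_measurable)

  have synth: "\<exists>X. L2_sums (\<lambda>j \<omega>. x j * expi (int j) \<omega>) X" if "x \<in> ell2_plus" for x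
    using L2_summable_expi[of x int] that by (auto simp: ell2_plus_def L2_summable_def)
  obtain G where G: "L2_sums (\<lambda>l \<omega>. g l * expi (int l) \<omega>) G"
    using synth[OF g] by blast
  obtain K where K: "L2_sums (\<lambda>l \<omega>. g l * analytic_part \<phi> l \<omega>) K" and hardy_K: "hardy K"
    and orth: "\<And>j. L2_inner (\<lambda>\<omega>. cnj (phi_fun \<phi> \<omega>) * G \<omega> - K \<omega>) (expi (int j)) = 0"
    using L2_sums_analytic_part[OF \<phi> phi_bdd g G] by auto
  have sq_G: "square_integrable G" and sq_K: "square_integrable K"
    using L2_sumsD(2)[OF G] hardy_square_integrable[OF hardy_K] .
  have sq_psi_K: "square_integrable (\<lambda>\<omega>. cnj (psi_fun \<psi> \<omega>) * K \<omega>)"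
    by (rule square_integrable_bounded_mult(1)[OF cnj_psi_bdd sq_K])

  define H0 where "H0 \<omega> = of_real (inverse s2) * (phi_fun \<phi> \<omega> * K \<omega>)" for \<omega>
  have hardy_H0: "hardy H0"
    unfolding H0_def[abs_def] by (intro hardy_cmult hardy_mult[OF hardy_phi hardy_K phi_bdd])
  have sq_H0: "square_integrable H0" by (rule hardy_square_integrable[OF hardy_H0])
  have f_H0: "AE \<omega> in circle. of_real (f \<omega>) * H0 \<omega> = cnj (psi_fun \<psi> \<omega>) * K \<omega>"
    using f_psi psi_phi
  proof eventually_elim
    case (elim \<omega>)
    have "complex_of_real (f \<omega>) = of_real s2 * (psi_fun \<psi> \<omega> * cnj (psi_fun \<psi> \<omega>))"
      unfolding elim(1) of_real_mult complex_norm_square ..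
    then have "of_real (f \<omega>) * H0 \<omega>
        = (of_real s2 * of_real (inverse s2)) * (psi_fun \<psi> \<omega> * phi_fun \<phi> \<omega>) * (cnj (psi_fun \<psi> \<omega>) * K \<omega>)"
      by (simp only: H0_def mult_ac)
    also have "\<dots> = cnj (psi_fun \<psi> \<omega>) * K \<omega>"
      using s2 elim(2) by simp
    finally show ?case .
  qed

  have f_H0_coef: "fcoef (\<lambda>\<omega>. of_real (f \<omega>) * H0 \<omega>) (int l) = g l" for l
  proof -
    define N where "N \<omega> = cnj (phi_fun \<phi> \<omega>) * G \<omega> - K \<omega>" for \<omega>
    have sq_N: "square_integrable N"
      unfolding N_def[abs_def]
      by (intro square_integrable_diff square_integrable_bounded_mult(1)[OF cnj_phi_bdd] sq_G sq_K)
    have sq_psi_N: "square_integrable (\<lambda>\<omega>. cnj (psi_fun \<psi> \<omega>) * N \<omega>)"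
      by (rule square_integrable_bounded_mult(1)[OF cnj_psi_bdd sq_N])
    \<comment> \<open>Why \<open>cnj \<psi>\<close> preserves negative frequencies: testing
      \<open>cnj \<psi>\<close> N against e_l is testing N against \<psi> e_l, which lies in the
      Hardy space.\<close>
    have "hardy (\<lambda>\<omega>. psi_fun \<psi> \<omega> * expi (int l) \<omega>)"
      by (intro hardy_mult[OF hardy_psi hardy_expi psi_bdd]) simp
    then have "L2_inner N (\<lambda>\<omega>. psi_fun \<psi> \<omega> * expi (int l) \<omega>) = 0"
      by (rule L2_inner_hardy_eq_0[OF sq_N, rotated]) (simp add: N_def[abs_def] orth)
    then have N0: "L2_inner (\<lambda>\<omega>. cnj (psi_fun \<psi> \<omega>) * N \<omega>) (expi (int l)) = 0"
      by (simp add: L2_inner_mult_left)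
    have "L2_inner (\<lambda>\<omega>. of_real (f \<omega>) * H0 \<omega>) (expi (int l))
        = L2_inner (\<lambda>\<omega>. G \<omega> - cnj (psi_fun \<psi> \<omega>) * N \<omega>) (expi (int l))"
    proof (rule L2_inner_cong_AE)
      show "AE \<omega> in circle. of_real (f \<omega>) * H0 \<omega> = G \<omega> - cnj (psi_fun \<psi> \<omega>) * N \<omega>"
        using f_H0 psi_phi
      proof eventually_elim
        case (elim \<omega>)
        have "cnj (psi_fun \<psi> \<omega>) * cnj (phi_fun \<phi> \<omega>) = 1"
          using arg_cong[OF elim(2), of cnj] by simp
        then have "cnj (psi_fun \<psi> \<omega>) * N \<omega> = G \<omega> - cnj (psi_fun \<psi> \<omega>) * K \<omega>"
          by (simp add: N_def right_diff_distrib flip: mult.assoc)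
        then show ?case by (simp add: elim(1))
      qed
      show "square_integrable (\<lambda>\<omega>. of_real (f \<omega>) * H0 \<omega>)"
        by (rule square_integrable_bounded_mult(1)[OF f_bdd sq_H0])
    qed (intro square_integrable_diff sq_G sq_psi_N square_integrable_expi)+
    also have "\<dots> = L2_inner G (expi (int l))"
      by (simp add: L2_inner_diff_left sq_G sq_psi_N square_integrable_expi N0)
    finally have "fcoef (\<lambda>\<omega>. of_real (f \<omega>) * H0 \<omega>) (int l) = fcoef G (int l)"
      by (simp add: fcoef_def)
    then show ?thesis using fcoef_L2_sums[OF G] by simp
  qed

  define h0 where "h0 j = fcoef H0 (int j)" for j
  have h0: "h0 \<in> ell2_plus"
    unfolding h0_def[abs_def] by (rule hardy_fcoef_ell2[OF hardy_H0])
  have h0_sums: "L2_sums (\<lambda>j \<omega>. h0 j * expi (int j) \<omega>) H0"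
    using hardy_H0 by (simp add: hardy_def h0_def)
  have h0_sol: "(\<lambda>j. h0 j * of_real (c (int l - int j))) sums g l" for l
    using toeplitz_sums[OF fourier f_meas f_abs h0_sums, of l] by (simp add: f_H0_coef)
  have sums_toeplitz: "(\<lambda>j. x j * of_real (c (int l - int j))) sums toeplitz c x l"
    if "x \<in> ell2_plus" for x l
    using toeplitz_sums[OF fourier f_meas f_abs] synth[OF that]
    by (auto simp: toeplitz_def sums_iff)
  have inj: "inj_on (toeplitz c) ell2_plus"
  proof (rule inj_onI)
    fix x y assume x: "x \<in> ell2_plus" and y: "y \<in> ell2_plus" and eq: "toeplitz c x = toeplitz c y"
    obtain X Y where X: "L2_sums (\<lambda>j \<omega>. x j * expi (int j) \<omega>) X"
      and Y: "L2_sums (\<lambda>j \<omega>. y j * expi (int j) \<omega>) Y"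
      using synth[OF x] synth[OF y] by blast
    note sq = L2_sumsD(2)[OF X] L2_sumsD(2)[OF Y]
    have "AE \<omega> in circle. X \<omega> - Y \<omega> = 0"
    proof (rule hardy_eq_0_if_toeplitz_eq_0[OF f_meas f_abs f_ge m])
      show "hardy (\<lambda>\<omega>. X \<omega> - Y \<omega>)"
        by (intro hardy_diff hardyI[OF X] hardyI[OF Y])
      fix l
      have "fcoef (\<lambda>\<omega>. of_real (f \<omega>) * (X \<omega> - Y \<omega>)) (int l)
          = fcoef (\<lambda>\<omega>. of_real (f \<omega>) * X \<omega>) (int l) - fcoef (\<lambda>\<omega>. of_real (f \<omega>) * Y \<omega>) (int l)"
        using sq by (simp add: right_diff_distrib fcoef_diff square_integrable_bounded_mult(1)[OF f_bdd])
      also have "\<dots> = toeplitz c x l - toeplitz c y l"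
        using toeplitz_sums[OF fourier f_meas f_abs X, of l] sums_toeplitz[OF x, of l]
          toeplitz_sums[OF fourier f_meas f_abs Y, of l] sums_toeplitz[OF y, of l]
        by (simp add: sums_iff)
      finally show "fcoef (\<lambda>\<omega>. of_real (f \<omega>) * (X \<omega> - Y \<omega>)) (int l) = 0"
        by (simp add: eq)
    qed
    then have "AE \<omega> in circle. X \<omega> = Y \<omega>" by simp
    \<comment> \<open>X and Y agree only almost everywhere; the sequences are recovered through
      coefficients, which ignore null sets.\<close>
    then have "fcoef X k = fcoef Y k" for k
      unfolding fcoef_def using sq by (simp add: L2_inner_cong_AE[of X Y] square_integrable_expi)
    then show "x = y"
      using fcoef_L2_sums[OF X] fcoef_L2_sums[OF Y] by (simp add: fun_eq_iff)
  qed
  have sol_iff: "(\<forall>l. (\<lambda>j. x j * of_real (c (int l - int j))) sums g l) \<longleftrightarrow> toeplitz c x = g"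
    if "x \<in> ell2_plus" for x
    using sums_toeplitz[OF that] by (auto simp: fun_eq_iff dest: sums_unique2)
  have T_h0: "toeplitz c h0 = g"
    using h0_sol sol_iff[OF h0] by simp
  \<comment> \<open>\<open>inv_into\<close> picks some preimage in \<open>ell2_plus\<close>;
    injectivity forces it to be \<open>h0\<close>.\<close>
  have h_eq: "h = h0"
    unfolding h toeplitz_inv_def by (rule inv_into_f_eq[OF inj h0, OF T_h0])
  have sol_unique: "{x \<in> ell2_plus. \<forall>l. (\<lambda>j. x j * of_real (c (int l - int j))) sums g l} = {h}"
    unfolding h_eq
  proof (intro set_eqI iffI)
    fix x assume x: "x \<in> {x \<in> ell2_plus. \<forall>l. (\<lambda>j. x j * of_real (c (int l - int j))) sums g l}"
    then have "toeplitz c x = toeplitz c h0" using sol_iff[of x] T_h0 by simp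
    then show "x \<in> {h0}" using inj_onD[OF inj] x h0 by simp
  qed (use h0 h0_sol in simp)

  have H_sums: "L2_sums (\<lambda>j \<omega>. h j * cis (real j * \<omega>)) H0"
    using h0_sums by (simp add: h_eq expi_int)
  have H_eq: "AE \<omega> in circle. H \<omega> = H0 \<omega>"
    unfolding H by (rule L2_suminf_AE_eq[OF H_sums])
  have K': "L2_sums (\<lambda>l \<omega>. g l * (cis (real l * \<omega>)
       - (\<Sum>s=1..l. of_real (\<phi> s) * cis (real (l - s) * \<omega>)))) K"
    using K by (simp only: analytic_part_def)
  have sq_term: "square_integrable
      (\<lambda>\<omega>. g l * (cis (real l * \<omega>) + cnj (psi_fun \<psi> \<omega>) * cnj (phi_tail \<phi> l \<omega>)))" for l
    unfolding expi_int using L2_sumsD(2)[OF L2_sums_phi_tail[OF \<phi>]]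
    by (intro square_integrable_cmult square_integrable_add square_integrable_expi
        square_integrable_bounded_mult(1)[OF cnj_psi_bdd] square_integrable_cnj)
  \<comment> \<open>The series of \<open>K\<close> times \<open>cnj \<psi>\<close>, term by term.
    Since \<psi> \<phi> = 1, the splitting of \<open>cnj \<phi>\<close> e_l turns
    \<open>cnj \<psi>\<close> u_l into e_l plus the product of the conjugates of \<psi> and
    \<phi>_l.\<close>
  have first: "L2_sums (\<lambda>l \<omega>. g l * (cis (real l * \<omega>) + cnj (psi_fun \<psi> \<omega>) * cnj (phi_tail \<phi> l \<omega>)))
      (\<lambda>\<omega>. cnj (psi_fun \<psi> \<omega>) * K \<omega>)"
  proof (rule L2_sums_cong_AE[OF L2_sums_bounded_mult[OF cnj_psi_bdd K] _ _ sq_term sq_psi_K])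
    fix l
    show "AE \<omega> in circle. cnj (psi_fun \<psi> \<omega>) * (g l * analytic_part \<phi> l \<omega>)
        = g l * (cis (real l * \<omega>) + cnj (psi_fun \<psi> \<omega>) * cnj (phi_tail \<phi> l \<omega>))"
      using cnj_phi_fun_mult_expi[OF \<phi>, of l] psi_phi
    proof eventually_elim
      case (elim \<omega>)
      have *: "cnj (psi_fun \<psi> \<omega>) * cnj (phi_fun \<phi> \<omega>) = 1"
        using arg_cong[OF elim(2), of cnj] by simp
      have "analytic_part \<phi> l \<omega> = cnj (phi_fun \<phi> \<omega>) * expi (int l) \<omega> + cnj (phi_tail \<phi> l \<omega>)"
        using elim(1) by simp
      then have "cnj (psi_fun \<psi> \<omega>) * analytic_part \<phi> l \<omega>
          = cis (real l * \<omega>) + cnj (psi_fun \<psi> \<omega>) * cnj (phi_tail \<phi> l \<omega>)"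
        by (simp add: distrib_left * expi_int flip: mult.assoc)
      then show ?case by (simp add: mult.left_commute[of "cnj (psi_fun \<psi> \<omega>)" "g l"])
    qed
  qed simp
  have eq1: "AE \<omega> in circle. H \<omega> =
       L2_suminf (\<lambda>l \<omega>. g l * (cis (real l * \<omega>) + cnj (psi_fun \<psi> \<omega>) * cnj (phi_tail \<phi> l \<omega>))) \<omega>
         / of_real (f \<omega>)"
    using H_eq L2_suminf_AE_eq[OF first] f_H0 f_ge
  proof eventually_elim
    case (elim \<omega>)
    have "of_real (f \<omega>) \<noteq> (0::complex)" using elim(4) m by simp
    then show ?case
      unfolding elim(1,2) elim(3)[symmetric] by (rule nonzero_mult_div_cancel_left[symmetric])
  qed
  have eq2: "AE \<omega> in circle. H \<omega> = of_real (inverse s2) * phi_fun \<phi> \<omega> *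
       L2_suminf (\<lambda>l \<omega>. g l * (cis (real l * \<omega>)
         - (\<Sum>s=1..l. of_real (\<phi> s) * cis (real (l - s) * \<omega>)))) \<omega>"
    using H_eq L2_suminf_AE_eq[OF K'] by eventually_elim (simp only: H0_def mult.assoc)
  show ?thesis
    using h0 h_eq sol_unique L2_summableI[OF H_sums] L2_summableI[OF first] eq1
      L2_summableI[OF K'] eq2
    by (intro conjI) simp_all
qed

end
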